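(* For a semigroup $S$, the following conditions are equivalent: (1) $S$ is an I-order in some primitive inverse semigroup; (2) $S$ has a zero and satisfies (A), (B), (C), (D), (C$'$) and (D$'$); (3) $S$ has a zero and satisfies (A), (B), (C), (D), (D$'$) and $\mathcal{R}^{*}\subseteq\rho$; (4) $S$ has a zero and satisfies (A), (B), (D), (D$'$), (E) and (E$'$); where, for a semigroup $S$ with zero $0$: (A) $S$ is categorical at $0$; (B) $S$ is $0$-cancellative; (C) $\lambda$ is transitive; (C$'$) $\rho$ is transitive; (D) $Sa\neq\{0\}$ for all nonzero $a\in S$; (D$'$) $aS\neq\{0\}$ for all nonzero $a\in S$; (E) for all $a,b\in S$: $a\,\rho\,b$ if and only if $a=b=0$ or there exists $x\in S$ with $xa\neq 0$ and $xb\neq 0$; (E$'$) for all $a,b\in S$: $a\,\lambda\,b$ if and only if $a=b=0$ or there exists $x\in S$ with $ax\neq 0$ and $bx\neq 0$.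
   Context: A semigroup $S$ with zero $0$ is categorical at $0$ if, for all $a,b,c\in S$, $ab\neq 0$ and $bc\neq 0$ imply $abc\neq 0$. It is $0$-cancellative if, for all $a,b,c\in S$, $ab=ac\neq 0$ implies $b=c$, and $ba=ca\neq 0$ implies $b=c$. On a semigroup $S$ with zero: $a\,\lambda\,b$ if and only if $a=b=0$ or $Sa\cap Sb\neq\{0\}$; $a\,\rho\,b$ if and only if $a=b=0$ or $aS\cap bS\neq\{0\}$; $a\,\mathcal{R}^{*}\,b$ if and only if for all $x,y\in S^{1}$, $xa=ya\Leftrightarrow xb=yb$. An inverse semigroup $Q$ with zero is primitive if every nonzero idempotent $e$ of $Q$ is primitive, i.e. for every idempotent $f$, $f\le e$ (that is, $ef=fe=f$) implies $f=0$ or $f=e$. A subsemigroup $S$ of an inverse semigroup $Q$ is an I-order in $Q$ if it is both a left I-order (every $q\in Q$ can be written as $a^{-1}b$ with $a,b\in S$) and a right I-order (every $q\in Q$ can be written as $ab^{-1}$ with $a,b\in S$), where inverses are taken in the inverse semigroup $Q$. An abstract semigroup $S$ is said to be an I-order in $Q$ if it embeds in $Q$ as such a subsemigroup. *)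

theory Defs
  imports "HOL-Algebra.Congruence"
begin

record 'a sgrp = "'a partial_object" +
  sg_mult :: "'a \<Rightarrow> 'a \<Rightarrow> 'a" (infixl "\<cdot>\<index>" 70)

locale carrier_semigroup =
  fixes S (structure)
  assumes closed: "\<lbrakk>a \<in> carrier S; b \<in> carrier S\<rbrakk> \<Longrightarrow> a \<cdot> b \<in> carrier S"
    and assoc: "\<lbrakk>a \<in> carrier S; b \<in> carrier S; c \<in> carrier S\<rbrakk> \<Longrightarrow> (a \<cdot> b) \<cdot> c = a \<cdot> (b \<cdot> c)"
    and nonempty: "carrier S \<noteq> {}"

definition is_zero :: "('a, 'm) sgrp_scheme \<Rightarrow> 'a \<Rightarrow> bool" where
  "is_zero S z \<longleftrightarrow> z \<in> carrier S \<and> (\<forall>a\<in>carrier S. z \<cdot>\<^bsub>S\<^esub> a = z \<and> a \<cdot>\<^bsub>S\<^esub> z = z)"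

definition is_identity :: "('a, 'm) sgrp_scheme \<Rightarrow> 'a \<Rightarrow> bool" where
  "is_identity S e \<longleftrightarrow> e \<in> carrier S \<and> (\<forall>a\<in>carrier S. e \<cdot>\<^bsub>S\<^esub> a = a \<and> a \<cdot>\<^bsub>S\<^esub> e = a)"


subsection \<open>Conditions on a semigroup with zero\<close>

text \<open>In this subsection \<open>z\<close> is the zero of \<open>S\<close>.\<close>

definition categorical_at_zero :: "('a, 'm) sgrp_scheme \<Rightarrow> 'a \<Rightarrow> bool" where
  "categorical_at_zero S z \<longleftrightarrow>
     (\<forall>a\<in>carrier S. \<forall>b\<in>carrier S. \<forall>c\<in>carrier S.
        a \<cdot>\<^bsub>S\<^esub> b \<noteq> z \<and> b \<cdot>\<^bsub>S\<^esub> c \<noteq> z \<longrightarrow> a \<cdot>\<^bsub>S\<^esub> b \<cdot>\<^bsub>S\<^esub> c \<noteq> z)"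

definition zero_cancellative :: "('a, 'm) sgrp_scheme \<Rightarrow> 'a \<Rightarrow> bool" where
  "zero_cancellative S z \<longleftrightarrow>
     (\<forall>a\<in>carrier S. \<forall>b\<in>carrier S. \<forall>c\<in>carrier S.
        (a \<cdot>\<^bsub>S\<^esub> b = a \<cdot>\<^bsub>S\<^esub> c \<and> a \<cdot>\<^bsub>S\<^esub> c \<noteq> z \<longrightarrow> b = c) \<and>
        (b \<cdot>\<^bsub>S\<^esub> a = c \<cdot>\<^bsub>S\<^esub> a \<and> c \<cdot>\<^bsub>S\<^esub> a \<noteq> z \<longrightarrow> b = c))"

definition left_multiples :: "('a, 'm) sgrp_scheme \<Rightarrow> 'a \<Rightarrow> 'a set" where
  "left_multiples S a = {s \<cdot>\<^bsub>S\<^esub> a | s. s \<in> carrier S}"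

definition right_multiples :: "('a, 'm) sgrp_scheme \<Rightarrow> 'a \<Rightarrow> 'a set" where
  "right_multiples S a = {a \<cdot>\<^bsub>S\<^esub> s | s. s \<in> carrier S}"

definition lambda_rel :: "('a, 'm) sgrp_scheme \<Rightarrow> 'a \<Rightarrow> 'a \<Rightarrow> 'a \<Rightarrow> bool" where
  "lambda_rel S z a b \<longleftrightarrow>
     (a = z \<and> b = z) \<or> left_multiples S a \<inter> left_multiples S b \<noteq> {z}"

definition rho_rel :: "('a, 'm) sgrp_scheme \<Rightarrow> 'a \<Rightarrow> 'a \<Rightarrow> 'a \<Rightarrow> bool" where
  "rho_rel S z a b \<longleftrightarrow>
     (a = z \<and> b = z) \<or> right_multiples S a \<inter> right_multiples S b \<noteq> {z}"

definition cond_D :: "('a, 'm) sgrp_scheme \<Rightarrow> 'a \<Rightarrow> bool" where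
  "cond_D S z \<longleftrightarrow> (\<forall>a\<in>carrier S. a \<noteq> z \<longrightarrow> left_multiples S a \<noteq> {z})"

definition cond_D' :: "('a, 'm) sgrp_scheme \<Rightarrow> 'a \<Rightarrow> bool" where
  "cond_D' S z \<longleftrightarrow> (\<forall>a\<in>carrier S. a \<noteq> z \<longrightarrow> right_multiples S a \<noteq> {z})"

definition cond_E :: "('a, 'm) sgrp_scheme \<Rightarrow> 'a \<Rightarrow> bool" where
  "cond_E S z \<longleftrightarrow>
     (\<forall>a\<in>carrier S. \<forall>b\<in>carrier S.
        rho_rel S z a b \<longleftrightarrow>
        (a = z \<and> b = z) \<or> (\<exists>x\<in>carrier S. x \<cdot>\<^bsub>S\<^esub> a \<noteq> z \<and> x \<cdot>\<^bsub>S\<^esub> b \<noteq> z))"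

definition cond_E' :: "('a, 'm) sgrp_scheme \<Rightarrow> 'a \<Rightarrow> bool" where
  "cond_E' S z \<longleftrightarrow>
     (\<forall>a\<in>carrier S. \<forall>b\<in>carrier S.
        lambda_rel S z a b \<longleftrightarrow>
        (a = z \<and> b = z) \<or> (\<exists>x\<in>carrier S. a \<cdot>\<^bsub>S\<^esub> x \<noteq> z \<and> b \<cdot>\<^bsub>S\<^esub> x \<noteq> z))"


subsection \<open>The relation \<open>\<R>\<^sup>*\<close>\<close>

text \<open>\<open>S\<^sup>1\<close>: elements of \<open>S\<close> are tagged with \<^const>\<open>Some\<close>, and
  \<^const>\<open>None\<close> is the new identity, present only if \<open>S\<close> has no identity of its own.\<close>

definition adjoin_one :: "('a, 'm) sgrp_scheme \<Rightarrow> 'a option sgrp" where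
  "adjoin_one S =
     \<lparr>carrier = Some ` carrier S \<union> (if \<exists>e. is_identity S e then {} else {None}),
      sg_mult = (\<lambda>x y. case x of None \<Rightarrow> y
                        | Some a \<Rightarrow> (case y of None \<Rightarrow> x | Some b \<Rightarrow> Some (a \<cdot>\<^bsub>S\<^esub> b)))\<rparr>"

definition R_star :: "('a, 'm) sgrp_scheme \<Rightarrow> 'a \<Rightarrow> 'a \<Rightarrow> bool" where
  "R_star S a b \<longleftrightarrow>
     (\<forall>x\<in>carrier (adjoin_one S). \<forall>y\<in>carrier (adjoin_one S).
        x \<cdot>\<^bsub>adjoin_one S\<^esub> Some a = y \<cdot>\<^bsub>adjoin_one S\<^esub> Some a \<longleftrightarrow>
        x \<cdot>\<^bsub>adjoin_one S\<^esub> Some b = y \<cdot>\<^bsub>adjoin_one S\<^esub> Some b)"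


subsection \<open>Inverse semigroups and I-orders\<close>

definition is_inverse_of :: "('a, 'm) sgrp_scheme \<Rightarrow> 'a \<Rightarrow> 'a \<Rightarrow> bool" where
  "is_inverse_of Q a b \<longleftrightarrow>
     b \<in> carrier Q \<and> a \<cdot>\<^bsub>Q\<^esub> b \<cdot>\<^bsub>Q\<^esub> a = a \<and> b \<cdot>\<^bsub>Q\<^esub> a \<cdot>\<^bsub>Q\<^esub> b = b"

locale inverse_semigroup = carrier_semigroup Q for Q (structure) +
  assumes ex1_inverse: "a \<in> carrier Q \<Longrightarrow> \<exists>!b. is_inverse_of Q a b"

definition sg_inv :: "('a, 'm) sgrp_scheme \<Rightarrow> 'a \<Rightarrow> 'a" where
  "sg_inv Q a = (THE b. is_inverse_of Q a b)"

definition idempotents :: "('a, 'm) sgrp_scheme \<Rightarrow> 'a set" where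
  "idempotents Q = {e \<in> carrier Q. e \<cdot>\<^bsub>Q\<^esub> e = e}"

definition primitive_inverse_semigroup :: "('a, 'm) sgrp_scheme \<Rightarrow> bool" where
  "primitive_inverse_semigroup Q \<longleftrightarrow>
     inverse_semigroup Q \<and>
     (\<exists>z. is_zero Q z \<and>
        (\<forall>e\<in>idempotents Q. e \<noteq> z \<longrightarrow>
           (\<forall>f\<in>idempotents Q. e \<cdot>\<^bsub>Q\<^esub> f = f \<and> f \<cdot>\<^bsub>Q\<^esub> e = f \<longrightarrow> f = z \<or> f = e)))"

definition subsemigroup :: "'a set \<Rightarrow> ('a, 'm) sgrp_scheme \<Rightarrow> bool" where
  "subsemigroup T Q \<longleftrightarrow>
     T \<noteq> {} \<and> T \<subseteq> carrier Q \<and> (\<forall>a\<in>T. \<forall>b\<in>T. a \<cdot>\<^bsub>Q\<^esub> b \<in> T)"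

definition left_I_order :: "'a set \<Rightarrow> ('a, 'm) sgrp_scheme \<Rightarrow> bool" where
  "left_I_order T Q \<longleftrightarrow>
     subsemigroup T Q \<and> (\<forall>q\<in>carrier Q. \<exists>a\<in>T. \<exists>b\<in>T. q = sg_inv Q a \<cdot>\<^bsub>Q\<^esub> b)"

definition right_I_order :: "'a set \<Rightarrow> ('a, 'm) sgrp_scheme \<Rightarrow> bool" where
  "right_I_order T Q \<longleftrightarrow>
     subsemigroup T Q \<and> (\<forall>q\<in>carrier Q. \<exists>a\<in>T. \<exists>b\<in>T. q = a \<cdot>\<^bsub>Q\<^esub> sg_inv Q b)"

definition I_order :: "'a set \<Rightarrow> ('a, 'm) sgrp_scheme \<Rightarrow> bool" where
  "I_order T Q \<longleftrightarrow> left_I_order T Q \<and> right_I_order T Q"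

definition sg_embedding :: "('a \<Rightarrow> 'b) \<Rightarrow> ('a, 'm) sgrp_scheme \<Rightarrow> ('b, 'n) sgrp_scheme \<Rightarrow> bool" where
  "sg_embedding h S Q \<longleftrightarrow>
     h \<in> carrier S \<rightarrow> carrier Q \<and> inj_on h (carrier S) \<and>
     (\<forall>a\<in>carrier S. \<forall>b\<in>carrier S. h (a \<cdot>\<^bsub>S\<^esub> b) = h a \<cdot>\<^bsub>Q\<^esub> h b)"

definition is_I_order_in :: "('a, 'm) sgrp_scheme \<Rightarrow> ('b, 'n) sgrp_scheme \<Rightarrow> bool" where
  "is_I_order_in S Q \<longleftrightarrow> (\<exists>h. sg_embedding h S Q \<and> I_order (h ` carrier S) Q)"

text \<open>A formula cannot quantify over types, so ``some primitive inverse semigroup'' is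
  read over semigroups whose elements are pairs of elements of the type of \<open>S\<close>. This
  is no restriction: if \<open>S\<close> is an I-order in \<open>Q\<close>, every element of \<open>Q\<close> is
  of the form \<open>a\<^sup>-\<^sup>1b\<close>, so \<open>Q\<close> has an isomorphic copy on a set of such pairs.\<close>

definition I_order_in_some_primitive :: "('a, 'm) sgrp_scheme \<Rightarrow> bool" where
  "I_order_in_some_primitive S \<longleftrightarrow>
     (\<exists>Q :: ('a \<times> 'a) sgrp. primitive_inverse_semigroup Q \<and> is_I_order_in S Q)"

end

theory Submission
  imports Defs
begin

text \<open>In a primitive inverse semigroup a product \<open>ab\<close> of nonzero elements is nonzero precisely when
  \<open>a\<^sup>-\<^sup>1a = bb\<^sup>-\<^sup>1\<close>. Hence in an I-order \<open>a \<lambda> b\<close> means \<open>a\<^sup>-\<^sup>1a = b\<^sup>-\<^sup>1b\<close> and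
  \<open>a \<rho> b\<close> means \<open>aa\<^sup>-\<^sup>1 = bb\<^sup>-\<^sup>1\<close>, which gives all the conditions. Conversely, nonzero fractions
  \<open>a\<^sup>-\<^sup>1b\<close> are classes of pairs with \<open>a \<rho> b\<close>, where \<open>(a, b) \<sim> (c, d)\<close> if \<open>xa = yc \<noteq> 0\<close> and
  \<open>xb = yd\<close> for some \<open>x\<close>, \<open>y\<close>. A class is a binary relation: the product is induced by relational
  composition, the inverse is the converse, and \<open>c\<close> corresponds to \<open>{(x, xc). xc \<noteq> 0}\<close>.
  For the conditions themselves, \<open>\<rho> \<subseteq> \<R>\<^sup>*\<close> holds under (A) and (B) alone, so that in (3)
  \<open>\<rho>\<close> coincides with the transitive relation \<open>\<R>\<^sup>*\<close>.\<close>


subsection \<open>Semigroups with zero and their opposites\<close>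

locale semigroup_with_zero = carrier_semigroup S for S (structure) +
  fixes z
  assumes zero: "is_zero S z"
begin

lemma zero_closed [simp]: "z \<in> carrier S"
  and zero_left [simp]: "a \<in> carrier S \<Longrightarrow> z \<cdot> a = z"
  and zero_right [simp]: "a \<in> carrier S \<Longrightarrow> a \<cdot> z = z"
  using zero by (auto simp: is_zero_def)

lemma mult_nonzeroD:
  assumes "a \<cdot> b \<noteq> z" "a \<in> carrier S" "b \<in> carrier S"
  shows "a \<noteq> z" "b \<noteq> z"
  using assms by auto

text \<open>The multiples of \<open>a\<close> and of \<open>b\<close> both include \<open>z\<close>,
  so a meet other than \<open>{z}\<close> amounts to a nonzero common left multiple.\<close>

lemma lambda_rel_iff:
  assumes "a \<in> carrier S" "b \<in> carrier S"
  shows "lambda_rel S z a b \<longleftrightarrow>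
    (a = z \<and> b = z) \<or> (\<exists>s\<in>carrier S. \<exists>t\<in>carrier S. s \<cdot> a = t \<cdot> b \<and> s \<cdot> a \<noteq> z)"
proof -
  have "z \<in> left_multiples S a \<inter> left_multiples S b"
    unfolding left_multiples_def using assms by (auto intro!: exI[of _ z])
  then have "left_multiples S a \<inter> left_multiples S b \<noteq> {z} \<longleftrightarrow>
      (\<exists>u \<in> left_multiples S a \<inter> left_multiples S b. u \<noteq> z)"
    by blast
  then show ?thesis
    unfolding lambda_rel_def by (auto simp: left_multiples_def)
qed

lemma rho_rel_iff:
  assumes "a \<in> carrier S" "b \<in> carrier S"
  shows "rho_rel S z a b \<longleftrightarrow>
    (a = z \<and> b = z) \<or> (\<exists>s\<in>carrier S. \<exists>t\<in>carrier S. a \<cdot> s = b \<cdot> t \<and> a \<cdot> s \<noteq> z)"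
proof -
  have "z \<in> right_multiples S a \<inter> right_multiples S b"
    unfolding right_multiples_def using assms by (auto intro!: exI[of _ z])
  then have "right_multiples S a \<inter> right_multiples S b \<noteq> {z} \<longleftrightarrow>
      (\<exists>u \<in> right_multiples S a \<inter> right_multiples S b. u \<noteq> z)"
    by blast
  then show ?thesis
    unfolding rho_rel_def by (auto simp: right_multiples_def)
qed

lemma cond_D_iff: "cond_D S z \<longleftrightarrow> (\<forall>a\<in>carrier S. a \<noteq> z \<longrightarrow> (\<exists>s\<in>carrier S. s \<cdot> a \<noteq> z))"
proof -
  have "z \<in> left_multiples S a" if "a \<in> carrier S" for a
    unfolding left_multiples_def using that by (auto intro!: exI[of _ z])
  then have "left_multiples S a \<noteq> {z} \<longleftrightarrow> (\<exists>s\<in>carrier S. s \<cdot> a \<noteq> z)" if "a \<in> carrier S" for a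
    using that by (auto simp: left_multiples_def)
  then show ?thesis unfolding cond_D_def by blast
qed

lemma cond_D'_iff: "cond_D' S z \<longleftrightarrow> (\<forall>a\<in>carrier S. a \<noteq> z \<longrightarrow> (\<exists>s\<in>carrier S. a \<cdot> s \<noteq> z))"
proof -
  have "z \<in> right_multiples S a" if "a \<in> carrier S" for a
    unfolding right_multiples_def using that by (auto intro!: exI[of _ z])
  then have "right_multiples S a \<noteq> {z} \<longleftrightarrow> (\<exists>s\<in>carrier S. a \<cdot> s \<noteq> z)" if "a \<in> carrier S" for a
    using that by (auto simp: right_multiples_def)
  then show ?thesis unfolding cond_D'_def by blast
qed

end

text \<open>Carries the left-right duality: a result on \<lambda> and (E') is read off from its
  counterpart on \<rho> and (E), or the other way round, by passing to \<open>opp S\<close>.\<close>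

definition opp :: "('a, 'm) sgrp_scheme \<Rightarrow> 'a sgrp" where
  "opp S = \<lparr>carrier = carrier S, sg_mult = (\<lambda>x y. y \<cdot>\<^bsub>S\<^esub> x)\<rparr>"

lemma opp_simps [simp]:
  "carrier (opp S) = carrier S" "x \<cdot>\<^bsub>opp S\<^esub> y = y \<cdot>\<^bsub>S\<^esub> x"
  by (simp_all add: opp_def)

lemma opp_conditions [simp]:
  "is_zero (opp S) z \<longleftrightarrow> is_zero S z"
  "zero_cancellative (opp S) z \<longleftrightarrow> zero_cancellative S z"
  "rho_rel (opp S) = lambda_rel S"
  "lambda_rel (opp S) = rho_rel S"
  "cond_D (opp S) z \<longleftrightarrow> cond_D' S z"
  "cond_D' (opp S) z \<longleftrightarrow> cond_D S z"
  "cond_E (opp S) z \<longleftrightarrow> cond_E' S z"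
  "cond_E' (opp S) z \<longleftrightarrow> cond_E S z"
proof -
  have *: "right_multiples (opp S) = left_multiples S" "left_multiples (opp S) = right_multiples S"
    by (auto simp: right_multiples_def left_multiples_def fun_eq_iff)
  show **: "rho_rel (opp S) = lambda_rel S" "lambda_rel (opp S) = rho_rel S"
    by (simp_all add: lambda_rel_def rho_rel_def * fun_eq_iff)
  show "is_zero (opp S) z \<longleftrightarrow> is_zero S z" by (auto simp: is_zero_def)
  show "zero_cancellative (opp S) z \<longleftrightarrow> zero_cancellative S z"
    unfolding zero_cancellative_def by auto
  show "cond_D (opp S) z \<longleftrightarrow> cond_D' S z" "cond_D' (opp S) z \<longleftrightarrow> cond_D S z"
    by (simp_all add: cond_D_def cond_D'_def *)
  show "cond_E (opp S) z \<longleftrightarrow> cond_E' S z" "cond_E' (opp S) z \<longleftrightarrow> cond_E S z"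
    by (simp_all add: cond_E_def cond_E'_def **)
qed

lemma (in carrier_semigroup) carrier_semigroup_opp: "carrier_semigroup (opp S)"
  by unfold_locales (auto simp: closed assoc nonempty)

lemma (in carrier_semigroup) is_inverse_of_opp:
  assumes "a \<in> carrier S"
  shows "is_inverse_of (opp S) a = is_inverse_of S a"
  unfolding fun_eq_iff is_inverse_of_def using assms by (auto simp: assoc closed)


subsection \<open>Conditions (A), (B), (D), (D')\<close>

locale categorical_cancellative = semigroup_with_zero +
  assumes categorical: "categorical_at_zero S z"
    and cancellative: "zero_cancellative S z"
    and cond_D: "cond_D S z"
    and cond_D': "cond_D' S z"
begin

lemma mult3_nonzero:
  assumes "a \<cdot> b \<noteq> z" "b \<cdot> c \<noteq> z" "a \<in> carrier S" "b \<in> carrier S" "c \<in> carrier S"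
  shows "a \<cdot> (b \<cdot> c) \<noteq> z"
  using categorical assms by (auto simp: categorical_at_zero_def assoc)

lemma left_cancel:
  assumes "a \<cdot> b = a \<cdot> c" "a \<cdot> b \<noteq> z" "a \<in> carrier S" "b \<in> carrier S" "c \<in> carrier S"
  shows "b = c"
  using cancellative assms unfolding zero_cancellative_def by metis

lemma right_cancel:
  assumes "b \<cdot> a = c \<cdot> a" "b \<cdot> a \<noteq> z" "a \<in> carrier S" "b \<in> carrier S" "c \<in> carrier S"
  shows "b = c"
  using cancellative assms unfolding zero_cancellative_def by metis

lemma exists_left:
  assumes "a \<in> carrier S" "a \<noteq> z"
  obtains s where "s \<in> carrier S" "s \<cdot> a \<noteq> z"
  using cond_D assms unfolding cond_D_iff by blast

lemma exists_right:
  assumes "a \<in> carrier S" "a \<noteq> z"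
  obtains s where "s \<in> carrier S" "a \<cdot> s \<noteq> z"
  using cond_D' assms unfolding cond_D'_iff by blast

lemma categorical_cancellative_opp: "categorical_cancellative (opp S) z"
proof -
  interpret opp: carrier_semigroup "opp S" by (rule carrier_semigroup_opp)
  show ?thesis
  proof unfold_locales
    \<comment> \<open>In \<open>opp S\<close> the triple product is bracketed the other way, so this
      condition passes to the dual through associativity.\<close>
    show "categorical_at_zero (opp S) z"
      unfolding categorical_at_zero_def using mult3_nonzero by simp
  qed (simp_all add: zero cancellative cond_D cond_D')
qed

section \<open>Transitivity of \<rho> and \<lambda> against (E) and (E')\<close>

lemma rho_mult_nonzero:
  assumes rho: "rho_rel S z a b" and mem: "a \<in> carrier S" "b \<in> carrier S" "x \<in> carrier S"
    and nz: "x \<cdot> a \<noteq> z"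
  shows "x \<cdot> b \<noteq> z"
\<comment> \<open>With \<open>a \<cdot> s = b \<cdot> t\<close> nonzero, categoricity keeps
  \<open>x \<cdot> (a \<cdot> s)\<close> nonzero, whereas \<open>x \<cdot> b = z\<close> would make
  \<open>x \<cdot> (b \<cdot> t)\<close> zero.\<close>
proof
  assume eq: "x \<cdot> b = z"
  have "a \<noteq> z" using nz mem by auto
  then obtain s t where st: "s \<in> carrier S" "t \<in> carrier S" "a \<cdot> s = b \<cdot> t" "a \<cdot> s \<noteq> z"
    using rho mem by (auto simp: rho_rel_iff)
  have "x \<cdot> (a \<cdot> s) \<noteq> z" using mult3_nonzero[OF nz st(4)] st mem by blast
  moreover have "x \<cdot> (b \<cdot> t) = z" using st mem eq by (simp flip: assoc)
  ultimately show False using st by simp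
qed

text \<open>If \<open>a\<close> \<rho> \<open>b\<close>, any \<open>x\<close> that does not kill
  \<open>a\<close> does not kill \<open>b\<close> either, and (D) supplies such an \<open>x\<close>.
  Conversely, \<open>x \<cdot> a\<close> and \<open>x \<cdot> b\<close> are both \<rho>-related to
  \<open>x\<close>; transitivity relates them to each other, and cancelling \<open>x\<close> returns
  to \<open>a\<close> and \<open>b\<close>.\<close>

lemma cond_E_if_transp:
  assumes trans: "transp_on (carrier S) (rho_rel S z)"
  shows "cond_E S z"
  unfolding cond_E_def
proof (intro ballI)
  fix a b assume mem: "a \<in> carrier S" "b \<in> carrier S"
  have "\<exists>x\<in>carrier S. x \<cdot> a \<noteq> z \<and> x \<cdot> b \<noteq> z" if rho: "rho_rel S z a b" and nz: "\<not> (a = z \<and> b = z)"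
  proof -
    have "a \<noteq> z" using rho nz mem by (auto simp: rho_rel_iff)
    then show ?thesis using exists_left mem rho_mult_nonzero[OF rho] by metis
  qed
  moreover have "rho_rel S z a b" if x: "x \<in> carrier S" "x \<cdot> a \<noteq> z" "x \<cdot> b \<noteq> z" for x
  proof -
    have rho_x: "rho_rel S z x (x \<cdot> c) \<and> rho_rel S z (x \<cdot> c) x"
      if c: "c \<in> carrier S" "x \<cdot> c \<noteq> z" for c
    proof -
      \<comment> \<open>The common right multiple of \<open>x\<close> and \<open>x \<cdot> c\<close>
        is \<open>x \<cdot> c \<cdot> u\<close>, nonzero for a suitable \<open>u\<close> by
        (D').\<close>
      obtain u where u: "u \<in> carrier S" "x \<cdot> c \<cdot> u \<noteq> z" using exists_right c x closed by metis
      then have "x \<cdot> (c \<cdot> u) = (x \<cdot> c) \<cdot> u" using c x by (simp add: assoc)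
      then show ?thesis using c x u closed by (simp add: rho_rel_iff) metis
    qed
    then have "rho_rel S z (x \<cdot> a) (x \<cdot> b)"
      using trans x mem closed unfolding transp_on_def by meson
    then obtain u v where uv: "u \<in> carrier S" "v \<in> carrier S" "x \<cdot> a \<cdot> u = x \<cdot> b \<cdot> v" "x \<cdot> a \<cdot> u \<noteq> z"
      using x mem closed by (auto simp: rho_rel_iff)
    have "a \<cdot> u = b \<cdot> v"
      by (rule left_cancel[of x]) (use uv x mem in \<open>simp_all add: closed flip: assoc\<close>)
    moreover have "a \<cdot> u \<noteq> z"
    proof
      assume "a \<cdot> u = z"
      then have "x \<cdot> a \<cdot> u = z" using uv(1) x(1) mem(1) by (simp add: assoc)
      then show False using uv(4) by simp
    qed
    ultimately show ?thesis using uv mem by (auto simp: rho_rel_iff)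
  qed
  moreover have "rho_rel S z a b" if "a = z \<and> b = z" using that by (simp add: rho_rel_def)
  ultimately show "rho_rel S z a b \<longleftrightarrow>
      (a = z \<and> b = z) \<or> (\<exists>x\<in>carrier S. x \<cdot> a \<noteq> z \<and> x \<cdot> b \<noteq> z)"
    by blast
qed

lemma cond_E'_if_transp:
  assumes "transp_on (carrier S) (lambda_rel S z)"
  shows "cond_E' S z"
  using categorical_cancellative.cond_E_if_transp[OF categorical_cancellative_opp] assms by simp

text \<open>Let \<open>x\<close> join \<open>a\<close> to \<open>b\<close> and \<open>y\<close> join
  \<open>b\<close> to \<open>c\<close>. Then \<open>b\<close> itself shows \<open>x\<close>
  \<lambda> \<open>y\<close> through (E'). From \<open>s \<cdot> x = t \<cdot> y\<close> nonzero,
  categoricity makes \<open>s \<cdot> (x \<cdot> a) = t \<cdot> (y \<cdot> a)\<close> nonzero; hence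
  \<open>y \<cdot> a \<noteq> z\<close>, and \<open>y\<close> joins \<open>a\<close> to
  \<open>c\<close>.\<close>

lemma transp_rho_if_cond_E:
  assumes E: "cond_E S z" and E': "cond_E' S z"
  shows "transp_on (carrier S) (rho_rel S z)"
proof (rule transp_onI)
  fix a b c
  assume mem: "a \<in> carrier S" "b \<in> carrier S" "c \<in> carrier S"
    and ab: "rho_rel S z a b" and bc: "rho_rel S z b c"
  show "rho_rel S z a c"
  proof (cases "b = z")
    case True
    then show ?thesis using ab bc mem by (auto simp: rho_rel_iff)
  next
    case False
    obtain x where x: "x \<in> carrier S" "x \<cdot> a \<noteq> z" "x \<cdot> b \<noteq> z"
      using E ab mem False unfolding cond_E_def by blast
    obtain y where y: "y \<in> carrier S" "y \<cdot> b \<noteq> z" "y \<cdot> c \<noteq> z"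
      using E bc mem False unfolding cond_E_def by blast
    have "lambda_rel S z x y" using E' x y mem unfolding cond_E'_def by blast
    moreover have "x \<noteq> z" using x mem by auto
    ultimately obtain s t where st: "s \<in> carrier S" "t \<in> carrier S" "s \<cdot> x = t \<cdot> y" "s \<cdot> x \<noteq> z"
      using x y by (auto simp: lambda_rel_iff)
    have "t \<cdot> (y \<cdot> a) = s \<cdot> (x \<cdot> a)" using st x y mem by (simp flip: assoc)
    moreover have "s \<cdot> (x \<cdot> a) \<noteq> z" using mult3_nonzero st x mem by simp
    ultimately have "y \<cdot> a \<noteq> z" using st by (metis zero_right)
    then show ?thesis using E y mem unfolding cond_E_def by blast
  qed
qed

lemma transp_lambda_if_cond_E:
  assumes "cond_E S z" "cond_E' S z"
  shows "transp_on (carrier S) (lambda_rel S z)"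
  using categorical_cancellative.transp_rho_if_cond_E[OF categorical_cancellative_opp] assms by simp

section \<open>Comparison of \<rho> with \<open>R_star\<close>\<close>

lemma R_star_imp_rho:
  assumes E: "cond_E S z" and R: "R_star S a b" and mem: "a \<in> carrier S" "b \<in> carrier S"
  shows "rho_rel S z a b"
proof -
  have iff: "x \<cdot> a = z \<longleftrightarrow> x \<cdot> b = z" if "x \<in> carrier S" for x
  proof -
    \<comment> \<open>Testing \<open>R_star\<close> on \<open>x\<close> against \<open>z\<close>
      shows that \<open>a\<close> and \<open>b\<close> have the same left annihilators in
      \<open>S\<close>; (D) and (E) then do the rest.\<close>
    have "Some x \<in> carrier (adjoin_one S)" "Some z \<in> carrier (adjoin_one S)"
      using that by (auto simp: adjoin_one_def)
    from R[unfolded R_star_def, rule_format, OF this] show ?thesis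
      using mem by (simp add: adjoin_one_def)
  qed
  show ?thesis
  proof (cases "a = z \<and> b = z")
    case False
    then obtain x where "x \<in> carrier S" "x \<cdot> a \<noteq> z \<or> x \<cdot> b \<noteq> z"
      using exists_left mem by metis
    then show ?thesis using iff E mem unfolding cond_E_def by blast
  qed (simp add: rho_rel_def)
qed

lemma rho_imp_R_star:
  assumes rho: "rho_rel S z a b" and mem: "a \<in> carrier S" "b \<in> carrier S"
  shows "R_star S a b"
proof -
  \<comment> \<open>\<open>act\<close> is the left action of \<open>S\<close> with an identity
    \<open>None\<close> adjoined. \<open>X\<close> always contains \<open>None\<close>, so it covers
    \<open>adjoin_one S\<close> whether or not \<open>S\<close> has an identity of its own.\<close>
  define act where "act x c = (case x of None \<Rightarrow> c | Some s \<Rightarrow> s \<cdot> c)" for x c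
  define X where "X = insert None (Some ` carrier S)"
  have act_closed: "act x c \<in> carrier S" if "x \<in> X" "c \<in> carrier S" for x c
    using that closed by (auto simp: act_def X_def)
  have act_assoc: "act x (c \<cdot> d) = act x c \<cdot> d" if "x \<in> X" "c \<in> carrier S" "d \<in> carrier S" for x c d
    using that by (auto simp: act_def X_def assoc)
  have imp: "act x d = act y d"
    if rho: "rho_rel S z c d" and mem: "c \<in> carrier S" "d \<in> carrier S"
      and xy: "x \<in> X" "y \<in> X" and eq: "act x c = act y c" for c d x y
  proof (cases "c = z \<and> d = z")
    case True
    then show ?thesis using eq by simp
  next
    case False
    then obtain s t where st: "s \<in> carrier S" "t \<in> carrier S" "c \<cdot> s = d \<cdot> t" "c \<cdot> s \<noteq> z"
      using rho mem by (auto simp: rho_rel_iff)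
    have eq': "act x d \<cdot> t = act y d \<cdot> t"
      using eq st mem xy by (metis act_assoc)
    \<comment> \<open>The factor \<open>t\<close> can be cancelled from \<open>eq'\<close> only if
      the common value is nonzero. If it is zero, categoricity forces \<open>act x d\<close> and
      \<open>act y d\<close> to be zero, and they agree all the same.\<close>
    have "act w d = z" if w: "w \<in> X" "act w d \<cdot> t = z" for w
    proof (cases w)
      case None
      then show ?thesis using w st by (simp add: act_def)
    next
      case (Some x)
      then have x: "x \<in> carrier S" "act w d = x \<cdot> d" using w by (auto simp: act_def X_def)
      then have "x \<cdot> (d \<cdot> t) = z" using w st mem by (simp add: assoc)
      moreover have "d \<cdot> t \<noteq> z" using st(3,4) by simp
      ultimately have "x \<cdot> d = z" using mult3_nonzero st(2) mem(2) x(1) by blast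
      then show ?thesis using x(2) by simp
    qed
    then show ?thesis
      using eq' right_cancel[of "act x d" t "act y d"] act_closed xy mem st by metis
  qed
  have sym: "rho_rel S z b a" using rho by (simp add: rho_rel_def Int_commute conj_commute)
  have "x \<cdot>\<^bsub>adjoin_one S\<^esub> Some c = Some (act x c)" for x c
    by (cases x) (simp_all add: adjoin_one_def act_def)
  moreover have "carrier (adjoin_one S) \<subseteq> X" by (auto simp: adjoin_one_def X_def)
  moreover have "act x a = act y a \<longleftrightarrow> act x b = act y b" if "x \<in> X" "y \<in> X" for x y
    using imp[OF rho mem that] imp[OF sym mem(2,1) that] by blast
  ultimately show ?thesis
    unfolding R_star_def by (metis (no_types) option.inject subsetD)
qed

text \<open>Together with \<open>rho_imp_R_star\<close> the assumption identifies \<rho> with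
  \<open>R_star\<close> on \<open>S\<close>, and the latter is transitive because it is defined by
  an equivalence for all \<open>x\<close> and \<open>y\<close>.\<close>

lemma transp_rho_if_R_star:
  assumes "\<forall>a\<in>carrier S. \<forall>b\<in>carrier S. R_star S a b \<longrightarrow> rho_rel S z a b"
  shows "transp_on (carrier S) (rho_rel S z)"
proof (rule transp_onI)
  fix a b c
  assume mem: "a \<in> carrier S" "b \<in> carrier S" "c \<in> carrier S"
    and "rho_rel S z a b" "rho_rel S z b c"
  then have "R_star S a b" "R_star S b c" using rho_imp_R_star by blast+
  then have "R_star S a c" unfolding R_star_def by simp
  then show "rho_rel S z a c" using assms mem by blast
qed

end


subsection \<open>Primitive inverse semigroups\<close>

context inverse_semigroup
begin

section \<open>Inverses and commuting idempotents in an inverse semigroup\<close>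

lemma is_inverse_of_inv:
  assumes "a \<in> carrier Q" shows "is_inverse_of Q a (sg_inv Q a)"
  unfolding sg_inv_def using theI'[OF ex1_inverse[OF assms]] .

lemma inv_closed [simp]: "a \<in> carrier Q \<Longrightarrow> sg_inv Q a \<in> carrier Q"
  and mult_inv_mult: "a \<in> carrier Q \<Longrightarrow> a \<cdot> (sg_inv Q a \<cdot> a) = a"
  and inv_mult_inv: "a \<in> carrier Q \<Longrightarrow> sg_inv Q a \<cdot> (a \<cdot> sg_inv Q a) = sg_inv Q a"
  using is_inverse_of_inv[of a] by (auto simp: is_inverse_of_def assoc)

lemma inverse_unique:
  assumes "a \<in> carrier Q" "is_inverse_of Q a b" "is_inverse_of Q a c"
  shows "b = c"
  using ex1_inverse assms by blast

text \<open>Let \<open>x\<close> be the inverse of \<open>e \<cdot> f\<close>. Then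
  \<open>f \<cdot> (x \<cdot> e)\<close> is another inverse of \<open>e \<cdot> f\<close>, so it
  equals \<open>x\<close>, which makes \<open>x\<close> idempotent. Hence \<open>x\<close> is its
  own inverse, but \<open>e \<cdot> f\<close> is an inverse of \<open>x\<close> as well, so
  \<open>e \<cdot> f = x\<close>.\<close>

lemma idempotents_mult:
  assumes ef: "e \<in> idempotents Q" "f \<in> idempotents Q"
  shows "e \<cdot> f \<in> idempotents Q"
proof -
  have e: "e \<in> carrier Q" "e \<cdot> e = e" and f: "f \<in> carrier Q" "f \<cdot> f = f"
    using ef by (auto simp: idempotents_def)
  have e': "e \<cdot> (e \<cdot> u) = e \<cdot> u" and f': "f \<cdot> (f \<cdot> u) = f \<cdot> u" if "u \<in> carrier Q" for u
    using that e f by (simp_all flip: assoc)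
  define x where "x = sg_inv Q (e \<cdot> f)"
  have x: "x \<in> carrier Q" by (simp add: x_def closed e f)
  have x1: "e \<cdot> (f \<cdot> (x \<cdot> (e \<cdot> f))) = e \<cdot> f" and x2: "x \<cdot> (e \<cdot> (f \<cdot> x)) = x"
    using mult_inv_mult[of "e \<cdot> f"] inv_mult_inv[of "e \<cdot> f"] e f x
    by (simp_all add: closed assoc flip: x_def)
  have x2': "x \<cdot> (e \<cdot> (f \<cdot> (x \<cdot> u))) = x \<cdot> u" if "u \<in> carrier Q" for u
  proof -
    have "x \<cdot> (e \<cdot> (f \<cdot> (x \<cdot> u))) = (x \<cdot> (e \<cdot> (f \<cdot> x))) \<cdot> u"
      using that e f x by (simp add: closed assoc)
    then show ?thesis by (simp add: x2)
  qed
  have "is_inverse_of Q (e \<cdot> f) (f \<cdot> (x \<cdot> e))"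
    unfolding is_inverse_of_def using e f x by (simp add: closed assoc e' f' x1 x2')
  moreover have "is_inverse_of Q (e \<cdot> f) x"
    unfolding x_def by (rule is_inverse_of_inv) (simp add: closed e f)
  ultimately have fxe: "f \<cdot> (x \<cdot> e) = x" using inverse_unique closed e f by metis
  have "x \<cdot> x = (f \<cdot> (x \<cdot> e)) \<cdot> (f \<cdot> (x \<cdot> e))" by (simp only: fxe)
  also have "\<dots> = f \<cdot> (x \<cdot> e)" using e f x by (simp add: closed assoc x2')
  also note fxe
  finally have xx: "x \<cdot> x = x" .
  have "is_inverse_of Q x x" unfolding is_inverse_of_def using x xx by simp
  moreover have "is_inverse_of Q x (e \<cdot> f)"
    unfolding is_inverse_of_def using e f x by (simp add: closed assoc x1 x2)
  ultimately have "e \<cdot> f = x" using inverse_unique x by blast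
  then show ?thesis using x xx by (simp add: idempotents_def)
qed

text \<open>Since both products are idempotent, \<open>f \<cdot> e\<close> and
  \<open>e \<cdot> f\<close> are both inverses of \<open>e \<cdot> f\<close>; uniqueness identifies
  them.\<close>

lemma idempotents_commute:
  assumes ef: "e \<in> idempotents Q" "f \<in> idempotents Q"
  shows "e \<cdot> f = f \<cdot> e"
proof -
  have e: "e \<in> carrier Q" "e \<cdot> e = e" and f: "f \<in> carrier Q" "f \<cdot> f = f"
    using ef by (auto simp: idempotents_def)
  have e': "e \<cdot> (e \<cdot> u) = e \<cdot> u" and f': "f \<cdot> (f \<cdot> u) = f \<cdot> u" if "u \<in> carrier Q" for u
    using that e f by (simp_all flip: assoc)
  have efef: "e \<cdot> (f \<cdot> (e \<cdot> f)) = e \<cdot> f" "f \<cdot> (e \<cdot> (f \<cdot> e)) = f \<cdot> e"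
    using idempotents_mult[of e f] idempotents_mult[of f e] ef e f
    by (simp_all add: idempotents_def closed assoc)
  have "is_inverse_of Q (e \<cdot> f) (f \<cdot> e)" "is_inverse_of Q (e \<cdot> f) (e \<cdot> f)"
    unfolding is_inverse_of_def using e f by (simp_all add: closed assoc e' f' efef)
  then show ?thesis using inverse_unique closed e f by metis
qed

lemma inv_mult_idempotent: "a \<in> carrier Q \<Longrightarrow> sg_inv Q a \<cdot> a \<in> idempotents Q"
  and mult_inv_idempotent: "a \<in> carrier Q \<Longrightarrow> a \<cdot> sg_inv Q a \<in> idempotents Q"
  by (simp_all add: idempotents_def closed assoc mult_inv_mult inv_mult_inv)

lemma sg_inv_opp: "a \<in> carrier Q \<Longrightarrow> sg_inv (opp Q) a = sg_inv Q a"
  by (simp add: sg_inv_def is_inverse_of_opp)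

lemma inverse_semigroup_opp: "inverse_semigroup (opp Q)"
proof -
  interpret opp: carrier_semigroup "opp Q" by (rule carrier_semigroup_opp)
  show ?thesis
    by unfold_locales (simp add: is_inverse_of_opp ex1_inverse)
qed

end

section \<open>Nonzero products under primitivity\<close>

locale primitive_inverse = inverse_semigroup +
  fixes zero_elt (\<open>\<zero>\<close>)
  assumes is_zero: "is_zero Q \<zero>"
    and primitive: "\<And>e f. \<lbrakk>e \<in> idempotents Q; f \<in> idempotents Q; e \<cdot> f = f; f \<cdot> e = f; f \<noteq> \<zero>\<rbrakk>
      \<Longrightarrow> f = e"
begin

sublocale semigroup_with_zero Q \<zero>
  by unfold_locales (rule is_zero)

text \<open>With \<open>e = a^-1 a\<close> and \<open>f = b b^-1\<close>,
  \<open>a \<cdot> b = a \<cdot> ((e \<cdot> f) \<cdot> b)\<close>. If this is nonzero,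
  \<open>e \<cdot> f\<close> is a nonzero idempotent below both \<open>e\<close> and
  \<open>f\<close>, so primitivity makes it equal to each. If \<open>e = f\<close>, then
  \<open>a = (a \<cdot> b) \<cdot> b^-1\<close>, so \<open>a \<cdot> b\<close> cannot
  vanish.\<close>

lemma mult_nonzero_iff:
  assumes mem: "a \<in> carrier Q" "b \<in> carrier Q" and nz: "a \<noteq> \<zero>" "b \<noteq> \<zero>"
  shows "a \<cdot> b \<noteq> \<zero> \<longleftrightarrow> sg_inv Q a \<cdot> a = b \<cdot> sg_inv Q b"
proof -
  define e f where "e = sg_inv Q a \<cdot> a" and "f = b \<cdot> sg_inv Q b"
  have ef: "e \<in> idempotents Q" "f \<in> idempotents Q" "e \<cdot> f \<in> idempotents Q"
    using mem by (simp_all add: e_def f_def inv_mult_idempotent mult_inv_idempotent idempotents_mult)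
  then have ef': "e \<in> carrier Q" "f \<in> carrier Q" "e \<cdot> e = e" "f \<cdot> f = f"
    by (auto simp: idempotents_def)
  have a: "a \<cdot> e = a" and b: "f \<cdot> b = b"
    using mem by (simp_all add: e_def f_def mult_inv_mult assoc)
  have ab: "a \<cdot> b = a \<cdot> ((e \<cdot> f) \<cdot> b)"
  proof -
    have "a \<cdot> b = (a \<cdot> e) \<cdot> (f \<cdot> b)" by (simp add: a b)
    also have "\<dots> = a \<cdot> ((e \<cdot> f) \<cdot> b)" using mem ef' by (simp add: closed assoc)
    finally show ?thesis .
  qed
  have "e = f" if "a \<cdot> b \<noteq> \<zero>"
  proof -
    have nz': "e \<cdot> f \<noteq> \<zero>" using that mem ab zero_left zero_right by metis
    have ee: "e \<cdot> (e \<cdot> f) = e \<cdot> f" using ef' by (simp flip: assoc)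
    have "(e \<cdot> f) \<cdot> e = e \<cdot> f" using ee ef idempotents_commute by metis
    then have "e \<cdot> f = e" using primitive ef nz' ee by blast
    moreover have ff: "(e \<cdot> f) \<cdot> f = e \<cdot> f" using ef' by (simp add: assoc)
    moreover have "f \<cdot> (e \<cdot> f) = e \<cdot> f" using ff ef idempotents_commute by metis
    ultimately show ?thesis using primitive ef nz' by metis
  qed
  moreover have "a \<cdot> b \<noteq> \<zero>" if "e = f"
  proof
    assume ab0: "a \<cdot> b = \<zero>"
    have "a = a \<cdot> (b \<cdot> sg_inv Q b)" using a that f_def by simp
    also have "\<dots> = (a \<cdot> b) \<cdot> sg_inv Q b" using mem by (simp add: assoc)
    finally show False using ab0 nz mem by simp
  qed
  ultimately show ?thesis unfolding e_def f_def by blast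
qed

text \<open>The product is fixed by \<open>b^-1 b\<close> on the right, so its own right-hand
  idempotent lies below \<open>b^-1 b\<close>; being nonzero, it is equal to it by
  primitivity.\<close>

lemma inv_mult_prod:
  assumes mem: "a \<in> carrier Q" "b \<in> carrier Q" and nz: "a \<cdot> b \<noteq> \<zero>"
  shows "sg_inv Q (a \<cdot> b) \<cdot> (a \<cdot> b) = sg_inv Q b \<cdot> b"
proof -
  define c where "c = a \<cdot> b"
  define e f where "e = sg_inv Q c \<cdot> c" and "f = sg_inv Q b \<cdot> b"
  have c: "c \<in> carrier Q" "c \<noteq> \<zero>" using mem nz by (simp_all add: c_def closed)
  have ef: "e \<in> idempotents Q" "f \<in> idempotents Q"
    using mem c by (simp_all add: e_def f_def inv_mult_idempotent)
  have "c \<cdot> f = c" using mem by (simp add: c_def f_def assoc closed mult_inv_mult)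
  then have *: "e \<cdot> f = e" using mem c by (simp add: e_def f_def assoc closed)
  then have "f \<cdot> e = e" using ef idempotents_commute by metis
  moreover have "e \<noteq> \<zero>" using mult_inv_mult[of c] c zero_right unfolding e_def by metis
  ultimately show ?thesis using primitive ef * unfolding e_def f_def c_def by metis
qed

lemma primitive_inverse_opp: "primitive_inverse (opp Q) \<zero>"
proof -
  interpret opp: inverse_semigroup "opp Q" by (rule inverse_semigroup_opp)
  show ?thesis
    by unfold_locales (auto simp: is_zero idempotents_def intro: primitive[unfolded idempotents_def])
qed

end

lemma primitive_inverse_semigroup_iff:
  "primitive_inverse_semigroup Q \<longleftrightarrow> (\<exists>z. primitive_inverse Q z)"
proof -
  \<comment> \<open>A nonzero \<open>f\<close> below \<open>e\<close> forces \<open>e\<close> to be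
    nonzero, so the locale's form of primitivity agrees with the definition.\<close>
  have "e \<noteq> z" if "is_zero Q z" "f \<in> idempotents Q" "e \<cdot>\<^bsub>Q\<^esub> f = f" "f \<noteq> z" for e f z
    using that by (auto simp: is_zero_def idempotents_def)
  then show ?thesis
    unfolding primitive_inverse_semigroup_def primitive_inverse_def primitive_inverse_axioms_def
    by blast
qed


subsection \<open>I-orders in primitive inverse semigroups\<close>

context inverse_semigroup
begin

lemma inv_inv: "a \<in> carrier Q \<Longrightarrow> sg_inv Q (sg_inv Q a) = a"
  by (rule inverse_unique[of "sg_inv Q a"])
    (simp_all add: is_inverse_of_inv, simp add: is_inverse_of_def assoc mult_inv_mult inv_mult_inv)

lemma I_order_opp:
  assumes "I_order T Q"
  shows "I_order T (opp Q)"
proof -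
  have T: "T \<subseteq> carrier Q" using assms by (simp add: I_order_def left_I_order_def subsemigroup_def)
  then have "sg_inv (opp Q) a = sg_inv Q a" if "a \<in> T" for a
    using that sg_inv_opp by blast
  then show ?thesis
    using assms by (simp add: I_order_def left_I_order_def right_I_order_def subsemigroup_def) meson
qed

end

locale primitive_I_order =
  primitive_inverse Q zero_elt + S: carrier_semigroup S
  for Q (structure) and zero_elt (\<open>\<zero>\<close>) and S :: "('b, 'n) sgrp_scheme" +
  fixes h
  assumes embedding: "sg_embedding h S Q"
    and I_order: "I_order (h ` carrier S) Q"
begin

lemma h_closed [simp]: "a \<in> carrier S \<Longrightarrow> h a \<in> carrier Q"
  and h_mult: "\<lbrakk>a \<in> carrier S; b \<in> carrier S\<rbrakk> \<Longrightarrow> h (a \<cdot>\<^bsub>S\<^esub> b) = h a \<cdot> h b"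
  and h_eq_iff: "\<lbrakk>a \<in> carrier S; b \<in> carrier S\<rbrakk> \<Longrightarrow> h a = h b \<longleftrightarrow> a = b"
  using embedding by (auto simp: sg_embedding_def inj_on_def)

lemma left_quotient:
  assumes "q \<in> carrier Q"
  obtains a b where "a \<in> carrier S" "b \<in> carrier S" "q = sg_inv Q (h a) \<cdot> h b"
  using I_order assms unfolding I_order_def left_I_order_def by blast

text \<open>Otherwise all products in the image are nonzero, so all the idempotents
  \<open>h a (h a)^-1\<close> coincide by \<open>mult_nonzero_iff\<close>. Writing \<zero> as
  \<open>(h a)^-1 h b\<close> then gives \<open>h b = h a (h a)^-1 h b = \<zero>\<close>, a
  contradiction.\<close>

lemma exists_h_zero: "\<exists>z\<in>carrier S. h z = \<zero>"
proof (rule ccontr)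
  assume "\<not> ?thesis"
  then have nz: "h a \<noteq> \<zero>" if "a \<in> carrier S" for a using that by blast
  have idem: "sg_inv Q (h a) \<cdot> h a = h b \<cdot> sg_inv Q (h b)" if "a \<in> carrier S" "b \<in> carrier S" for a b
    using that nz mult_nonzero_iff[of "h a" "h b"] by (simp add: S.closed flip: h_mult)
  obtain a b where ab: "a \<in> carrier S" "b \<in> carrier S" "\<zero> = sg_inv Q (h a) \<cdot> h b"
    using left_quotient zero_closed by metis
  have "h b = (h b \<cdot> sg_inv Q (h b)) \<cdot> h b" using ab by (simp add: assoc mult_inv_mult)
  also have "\<dots> = (h a \<cdot> sg_inv Q (h a)) \<cdot> h b" using ab idem by metis
  also have "\<dots> = h a \<cdot> (sg_inv Q (h a) \<cdot> h b)" using ab by (simp add: assoc)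
  also have "\<dots> = \<zero>" using ab by (simp flip: ab(3))
  finally show False using nz ab by blast
qed

lemma primitive_I_order_opp: "primitive_I_order (opp Q) \<zero> (opp S) h"
proof -
  interpret opp: primitive_inverse "opp Q" "\<zero>" by (rule primitive_inverse_opp)
  interpret S_opp: carrier_semigroup "opp S" by (rule S.carrier_semigroup_opp)
  show ?thesis
    using embedding I_order_opp[OF I_order]
    by unfold_locales (auto simp: sg_embedding_def)
qed

end

locale primitive_I_order_zero = primitive_I_order +
  fixes z
  assumes z: "z \<in> carrier S" and h_z: "h z = \<zero>"
begin

lemma h_zero_iff: "a \<in> carrier S \<Longrightarrow> h a = \<zero> \<longleftrightarrow> a = z"
  using h_eq_iff z h_z by metis

sublocale S: semigroup_with_zero S z
proof unfold_locales
  have "a \<cdot>\<^bsub>S\<^esub> z = z \<and> z \<cdot>\<^bsub>S\<^esub> a = z" if "a \<in> carrier S" for a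
    using that z by (simp add: S.closed h_mult h_z flip: h_zero_iff)
  then show "is_zero S z" using z by (simp add: is_zero_def)
qed

lemma S_mult_nonzero_iff:
  "\<lbrakk>a \<in> carrier S; b \<in> carrier S\<rbrakk> \<Longrightarrow> a \<cdot>\<^bsub>S\<^esub> b \<noteq> z \<longleftrightarrow> h a \<cdot> h b \<noteq> \<zero>"
  using h_zero_iff[of "a \<cdot>\<^bsub>S\<^esub> b"] by (simp add: S.closed h_mult)

text \<open>A nonzero product has the right-hand idempotent of its last factor, so a common nonzero
  left multiple forces equality. Conversely, \<open>q = h a (h b)^-1\<close> carries
  \<open>h b\<close> to \<open>h a\<close>, and writing \<open>q\<close> as a left quotient
  \<open>(h s)^-1 h t\<close> supplies multipliers with \<open>s a = t b\<close>.\<close>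

lemma lambda_rel_iff_idempotents_eq:
  assumes mem: "a \<in> carrier S" "b \<in> carrier S" and nz: "a \<noteq> z" "b \<noteq> z"
  shows "lambda_rel S z a b \<longleftrightarrow> sg_inv Q (h a) \<cdot> h a = sg_inv Q (h b) \<cdot> h b"
proof
  assume "lambda_rel S z a b"
  then obtain s t where st: "s \<in> carrier S" "t \<in> carrier S"
    and eq: "s \<cdot>\<^bsub>S\<^esub> a = t \<cdot>\<^bsub>S\<^esub> b" and "s \<cdot>\<^bsub>S\<^esub> a \<noteq> z"
    using mem nz by (auto simp: S.lambda_rel_iff)
  then have "h s \<cdot> h a \<noteq> \<zero>" "h s \<cdot> h a = h t \<cdot> h b"
    using mem S_mult_nonzero_iff h_mult by metis+
  then show "sg_inv Q (h a) \<cdot> h a = sg_inv Q (h b) \<cdot> h b"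
    using inv_mult_prod mem st h_closed by metis
next
  assume eq: "sg_inv Q (h a) \<cdot> h a = sg_inv Q (h b) \<cdot> h b"
  have nz': "h a \<noteq> \<zero>" "h b \<noteq> \<zero>" using mem nz by (simp_all add: h_zero_iff)
  define q where "q = h a \<cdot> sg_inv Q (h b)"
  have q: "q \<in> carrier Q" using mem by (simp add: q_def closed)
  have qb: "q \<cdot> h b = h a" using mem by (simp add: q_def assoc mult_inv_mult flip: eq)
  have "q \<noteq> \<zero>" using qb nz' mem by auto
  obtain s t where st: "s \<in> carrier S" "t \<in> carrier S" "q = sg_inv Q (h s) \<cdot> h t"
    using left_quotient q by metis
  have "sg_inv Q (h s) \<noteq> \<zero>" "h t \<noteq> \<zero>" using \<open>q \<noteq> \<zero>\<close> st mult_nonzeroD h_closed inv_closed by metis+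
  \<comment> \<open>By \<open>mult_nonzero_iff\<close> applied to the nonzero product
    \<open>q\<close> the idempotents of \<open>h s\<close> and \<open>h t\<close> agree, and
    therefore \<open>h s \<cdot> q = h t\<close>.\<close>
  then have "h s \<cdot> sg_inv Q (h s) = h t \<cdot> sg_inv Q (h t)"
    using mult_nonzero_iff[of "sg_inv Q (h s)" "h t"] \<open>q \<noteq> \<zero>\<close> st by (simp add: inv_inv)
  moreover have "h s \<cdot> q = (h s \<cdot> sg_inv Q (h s)) \<cdot> h t" using st by (simp add: assoc)
  ultimately have sq: "h s \<cdot> q = h t" using st by (simp add: assoc mult_inv_mult)
  have "h s \<cdot> h a = (h s \<cdot> q) \<cdot> h b" using qb q st mem by (simp add: assoc)
  then have sa: "h s \<cdot> h a = h t \<cdot> h b" by (simp add: sq)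
  have "h t = (h s \<cdot> h a) \<cdot> sg_inv Q (h b)" using sq st mem by (simp add: q_def assoc)
  then have "h s \<cdot> h a \<noteq> \<zero>" using \<open>h t \<noteq> \<zero>\<close> mem zero_left inv_closed h_closed by metis
  then have "s \<cdot>\<^bsub>S\<^esub> a \<noteq> z" using st mem S_mult_nonzero_iff by blast
  moreover have "s \<cdot>\<^bsub>S\<^esub> a = t \<cdot>\<^bsub>S\<^esub> b"
    using sa st mem h_eq_iff[of "s \<cdot>\<^bsub>S\<^esub> a" "t \<cdot>\<^bsub>S\<^esub> b"] by (simp add: S.closed h_mult)
  ultimately show "lambda_rel S z a b"
    using st mem unfolding S.lambda_rel_iff[OF mem] by blast
qed

lemma transp_lambda: "transp_on (carrier S) (lambda_rel S z)"
proof (rule transp_onI)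
  fix a b c
  assume mem: "a \<in> carrier S" "b \<in> carrier S" "c \<in> carrier S"
    and ab: "lambda_rel S z a b" and bc: "lambda_rel S z b c"
  have "a = z \<longleftrightarrow> b = z" "b = z \<longleftrightarrow> c = z"
    using ab bc mem by (auto simp: S.lambda_rel_iff)
  then show "lambda_rel S z a c"
    using ab bc mem lambda_rel_iff_idempotents_eq by (cases "b = z") (simp_all add: lambda_rel_def)
qed

text \<open>The idempotent criterion makes \<lambda> reflexive, and a nonzero common left multiple
  of \<open>a\<close> with itself is what (D) asks for.\<close>

lemma cond_D: "cond_D S z"
  unfolding S.cond_D_iff
proof (intro ballI impI)
  fix a assume "a \<in> carrier S" "a \<noteq> z"
  then have "lambda_rel S z a a" by (simp add: lambda_rel_iff_idempotents_eq)
  then show "\<exists>s\<in>carrier S. s \<cdot>\<^bsub>S\<^esub> a \<noteq> z"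
    using \<open>a \<in> carrier S\<close> \<open>a \<noteq> z\<close> by (auto simp: S.lambda_rel_iff)
qed

lemma primitive_I_order_zero_opp: "primitive_I_order_zero (opp Q) \<zero> (opp S) h z"
proof -
  interpret opp: primitive_I_order "opp Q" \<zero> "opp S" h by (rule primitive_I_order_opp)
  show ?thesis by unfold_locales (simp_all add: z h_z)
qed

lemma transp_rho: "transp_on (carrier S) (rho_rel S z)"
  and cond_D': "cond_D' S z"
  using primitive_I_order_zero.transp_lambda[OF primitive_I_order_zero_opp]
    primitive_I_order_zero.cond_D[OF primitive_I_order_zero_opp] by simp_all

text \<open>By \<open>inv_mult_prod\<close>, \<open>a b\<close> has the same right-hand idempotent
  as \<open>b\<close>, so whether a product with \<open>c\<close> vanishes is decided in the same
  way for \<open>a b\<close> as for \<open>b\<close>.\<close>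

lemma categorical: "categorical_at_zero S z"
  unfolding categorical_at_zero_def
proof (intro ballI impI)
  fix a b c
  assume mem: "a \<in> carrier S" "b \<in> carrier S" "c \<in> carrier S"
    and nz: "a \<cdot>\<^bsub>S\<^esub> b \<noteq> z \<and> b \<cdot>\<^bsub>S\<^esub> c \<noteq> z"
  have ab: "h a \<cdot> h b \<noteq> \<zero>" and bc: "h b \<cdot> h c \<noteq> \<zero>"
    using nz mem S_mult_nonzero_iff by blast+
  have "h b \<noteq> \<zero>" "h c \<noteq> \<zero>" using mult_nonzeroD[OF bc] mem by simp_all
  then have "sg_inv Q (h b) \<cdot> h b = h c \<cdot> sg_inv Q (h c)"
    using bc mem mult_nonzero_iff by simp
  then have "sg_inv Q (h a \<cdot> h b) \<cdot> (h a \<cdot> h b) = h c \<cdot> sg_inv Q (h c)"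
    using inv_mult_prod ab mem by simp
  then have "(h a \<cdot> h b) \<cdot> h c \<noteq> \<zero>"
    using mult_nonzero_iff[of "h a \<cdot> h b" "h c"] ab \<open>h c \<noteq> \<zero>\<close> mem by (simp add: closed)
  then show "a \<cdot>\<^bsub>S\<^esub> b \<cdot>\<^bsub>S\<^esub> c \<noteq> z"
    using mem by (simp add: S_mult_nonzero_iff S.closed h_mult)
qed

text \<open>In \<open>Q\<close> the right factor of a nonzero product can be recovered as
  \<open>d = a^-1 (a d)\<close>, because \<open>a^-1 a = d d^-1\<close>.\<close>

lemma S_left_cancel:
  assumes mem: "a \<in> carrier S" "b \<in> carrier S" "c \<in> carrier S"
    and eq: "a \<cdot>\<^bsub>S\<^esub> b = a \<cdot>\<^bsub>S\<^esub> c" and nz: "a \<cdot>\<^bsub>S\<^esub> c \<noteq> z"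
  shows "b = c"
proof -
  have recover: "h d = sg_inv Q (h a) \<cdot> (h a \<cdot> h d)"
    if d: "d \<in> carrier S" "h a \<cdot> h d \<noteq> \<zero>" for d
  proof -
    have "h a \<noteq> \<zero>" "h d \<noteq> \<zero>" using mult_nonzeroD[OF d(2)] d(1) mem by simp_all
    then have "sg_inv Q (h a) \<cdot> h a = h d \<cdot> sg_inv Q (h d)"
      using d mem mult_nonzero_iff by simp
    moreover have "sg_inv Q (h a) \<cdot> (h a \<cdot> h d) = (sg_inv Q (h a) \<cdot> h a) \<cdot> h d"
      using d mem by (simp add: assoc)
    ultimately show ?thesis using d by (simp add: assoc mult_inv_mult)
  qed
  have "h a \<cdot> h c \<noteq> \<zero>" using nz mem S_mult_nonzero_iff by blast
  moreover have "h a \<cdot> h b = h a \<cdot> h c" using eq mem h_mult by metis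
  ultimately have "h b = h c" using recover mem by metis
  then show ?thesis using h_eq_iff mem by blast
qed

lemma cancellative: "zero_cancellative S z"
  unfolding zero_cancellative_def
proof (intro ballI conjI impI; elim conjE)
  fix a b c
  assume mem: "a \<in> carrier S" "b \<in> carrier S" "c \<in> carrier S"
  show "b = c" if "a \<cdot>\<^bsub>S\<^esub> b = a \<cdot>\<^bsub>S\<^esub> c" "a \<cdot>\<^bsub>S\<^esub> c \<noteq> z"
    using S_left_cancel mem that by blast
  show "b = c" if "b \<cdot>\<^bsub>S\<^esub> a = c \<cdot>\<^bsub>S\<^esub> a" "c \<cdot>\<^bsub>S\<^esub> a \<noteq> z"
    by (rule primitive_I_order_zero.S_left_cancel[OF primitive_I_order_zero_opp])
      (use mem that in simp_all)
qed

lemma categorical_cancellative: "categorical_cancellative S z"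
  by unfold_locales (rule categorical cancellative cond_D cond_D')+

end

lemma primitive_I_order_conditions:
  assumes S: "carrier_semigroup S" and Q: "primitive_inverse_semigroup Q" and "is_I_order_in S Q"
  shows "\<exists>z. categorical_cancellative S z \<and>
    transp_on (carrier S) (lambda_rel S z) \<and> transp_on (carrier S) (rho_rel S z)"
proof -
  obtain zQ where "primitive_inverse Q zQ" using Q unfolding primitive_inverse_semigroup_iff by blast
  then interpret primitive_inverse Q zQ .
  interpret S: carrier_semigroup S by (rule S)
  obtain h where "sg_embedding h S Q" "I_order (h ` carrier S) Q"
    using assms unfolding is_I_order_in_def by blast
  then interpret primitive_I_order Q zQ S h by unfold_locales
  \<comment> \<open>The zero of \<open>S\<close> is the element that the embedding sends to the zero
    of \<open>Q\<close>.\<close>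
  obtain z where "z \<in> carrier S" "h z = zQ" using exists_h_zero by blast
  then interpret primitive_I_order_zero Q zQ S h z by unfold_locales
  show ?thesis using categorical_cancellative transp_lambda transp_rho by blast
qed

section \<open>Transport along isomorphisms, and the copy on pairs\<close>

lemma is_inverse_of_isomorphic:
  assumes Q: "carrier_semigroup Q" and inj: "inj_on \<phi> (carrier Q)"
    and Q': "carrier Q' = \<phi> ` carrier Q"
    and mult: "\<And>x y. \<lbrakk>x \<in> carrier Q; y \<in> carrier Q\<rbrakk> \<Longrightarrow> \<phi> x \<cdot>\<^bsub>Q'\<^esub> \<phi> y = \<phi> (x \<cdot>\<^bsub>Q\<^esub> y)"
    and mem: "x \<in> carrier Q" "y \<in> carrier Q"
  shows "is_inverse_of Q' (\<phi> x) (\<phi> y) \<longleftrightarrow> is_inverse_of Q x y"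
proof -
  interpret carrier_semigroup Q by (rule Q)
  show ?thesis
    unfolding is_inverse_of_def using mem by (simp add: Q' mult closed inj_on_eq_iff[OF inj])
qed

lemma primitive_inverse_semigroup_isomorphic:
  assumes Q: "primitive_inverse_semigroup Q" and inj: "inj_on \<phi> (carrier Q)"
    and Q': "carrier Q' = \<phi> ` carrier Q"
    and mult: "\<And>x y. \<lbrakk>x \<in> carrier Q; y \<in> carrier Q\<rbrakk> \<Longrightarrow> \<phi> x \<cdot>\<^bsub>Q'\<^esub> \<phi> y = \<phi> (x \<cdot>\<^bsub>Q\<^esub> y)"
  shows "primitive_inverse_semigroup Q'"
proof -
  obtain z where "primitive_inverse Q z" using Q unfolding primitive_inverse_semigroup_iff by blast
  then interpret primitive_inverse Q z .
  interpret Q': carrier_semigroup Q'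
  proof unfold_locales
    show "a \<cdot>\<^bsub>Q'\<^esub> b \<in> carrier Q'" if "a \<in> carrier Q'" "b \<in> carrier Q'" for a b
      using that unfolding Q' by (elim imageE) (simp add: mult closed)
    show "a \<cdot>\<^bsub>Q'\<^esub> b \<cdot>\<^bsub>Q'\<^esub> c = a \<cdot>\<^bsub>Q'\<^esub> (b \<cdot>\<^bsub>Q'\<^esub> c)"
      if "a \<in> carrier Q'" "b \<in> carrier Q'" "c \<in> carrier Q'" for a b c
      using that unfolding Q' by (elim imageE) (simp add: mult closed assoc)
    show "carrier Q' \<noteq> {}" using nonempty by (simp add: Q')
  qed
  interpret Q': inverse_semigroup Q'
  proof unfold_locales
    fix a assume "a \<in> carrier Q'"
    then obtain x where x: "a = \<phi> x" "x \<in> carrier Q" by (auto simp: Q')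
    have iff: "is_inverse_of Q' a (\<phi> y) \<longleftrightarrow> is_inverse_of Q x y" if "y \<in> carrier Q" for y
      using is_inverse_of_isomorphic[OF carrier_semigroup_axioms inj Q' mult] x that by simp
    show "\<exists>!b. is_inverse_of Q' a b"
    proof (rule ex1I)
      show "is_inverse_of Q' a (\<phi> (sg_inv Q x))" using x(2) by (simp add: iff is_inverse_of_inv)
      fix b assume b: "is_inverse_of Q' a b"
      then obtain y where "b = \<phi> y" "y \<in> carrier Q" by (auto simp: is_inverse_of_def Q')
      then show "b = \<phi> (sg_inv Q x)"
        using b x iff inverse_unique is_inverse_of_inv by metis
    qed
  qed
  have idem: "idempotents Q' = \<phi> ` idempotents Q"
    by (auto simp: idempotents_def Q' mult closed inj_on_eq_iff[OF inj])
  have "primitive_inverse Q' (\<phi> z)"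
  proof unfold_locales
    show "is_zero Q' (\<phi> z)" using is_zero by (auto simp: is_zero_def Q' mult)
    fix e f
    assume "e \<in> idempotents Q'" "f \<in> idempotents Q'" and ef: "e \<cdot>\<^bsub>Q'\<^esub> f = f" "f \<cdot>\<^bsub>Q'\<^esub> e = f" "f \<noteq> \<phi> z"
    then obtain e' f' where e'f': "e = \<phi> e'" "f = \<phi> f'" "e' \<in> idempotents Q" "f' \<in> idempotents Q"
      unfolding idem by blast
    then have mem: "e' \<in> carrier Q" "f' \<in> carrier Q" by (simp_all add: idempotents_def)
    have "e' \<cdot>\<^bsub>Q\<^esub> f' = f'" "f' \<cdot>\<^bsub>Q\<^esub> e' = f'"
      using ef mem by (simp_all add: e'f' mult closed inj_on_eq_iff[OF inj])
    then show "f = e" using primitive e'f' ef(3) by metis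
  qed
  then show ?thesis unfolding primitive_inverse_semigroup_iff by blast
qed

lemma is_I_order_in_isomorphic:
  assumes Q: "primitive_inverse_semigroup Q" and inj: "inj_on \<phi> (carrier Q)"
    and Q': "carrier Q' = \<phi> ` carrier Q"
    and mult: "\<And>x y. \<lbrakk>x \<in> carrier Q; y \<in> carrier Q\<rbrakk> \<Longrightarrow> \<phi> x \<cdot>\<^bsub>Q'\<^esub> \<phi> y = \<phi> (x \<cdot>\<^bsub>Q\<^esub> y)"
    and "is_I_order_in S Q"
  shows "is_I_order_in S Q'"
proof -
  interpret inverse_semigroup Q using Q by (simp add: primitive_inverse_semigroup_def)
  have "primitive_inverse_semigroup Q'"
    \<comment> \<open>Uniqueness of inverses in \<open>Q'\<close>, available from here on, makes
      \<phi> commute with \<open>sg_inv\<close>.\<close>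
    using primitive_inverse_semigroup_isomorphic[OF Q inj Q' mult] .
  then interpret Q': inverse_semigroup Q' by (simp add: primitive_inverse_semigroup_def)
  have inv: "sg_inv Q' (\<phi> x) = \<phi> (sg_inv Q x)" if x: "x \<in> carrier Q" for x
  proof (rule Q'.inverse_unique)
    show "\<phi> x \<in> carrier Q'" using x by (simp add: Q')
    then show "is_inverse_of Q' (\<phi> x) (sg_inv Q' (\<phi> x))" by (rule Q'.is_inverse_of_inv)
    show "is_inverse_of Q' (\<phi> x) (\<phi> (sg_inv Q x))"
      using is_inverse_of_isomorphic[OF carrier_semigroup_axioms inj Q' mult] x is_inverse_of_inv
      by simp
  qed
  obtain h where h: "sg_embedding h S Q" "I_order (h ` carrier S) Q"
    using assms(5) unfolding is_I_order_in_def by blast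
  have T: "h a \<in> carrier Q" if "a \<in> carrier S" for a
    using h(1) that by (auto simp: sg_embedding_def)
  have "sg_embedding (\<phi> \<circ> h) S Q'"
    using h(1) T inj by (auto simp: sg_embedding_def Q' mult inj_on_def)
  moreover have "subsemigroup ((\<phi> \<circ> h) ` carrier S) Q'"
  proof -
    have sub: "subsemigroup (h ` carrier S) Q" using h(2) by (simp add: I_order_def left_I_order_def)
    then have "h a \<cdot>\<^bsub>Q\<^esub> h b \<in> h ` carrier S" if "a \<in> carrier S" "b \<in> carrier S" for a b
      using that by (simp add: subsemigroup_def)
    then have "\<phi> (h a) \<cdot>\<^bsub>Q'\<^esub> \<phi> (h b) \<in> (\<phi> \<circ> h) ` carrier S"
      if "a \<in> carrier S" "b \<in> carrier S" for a b
      using that T by (simp only: mult image_comp[symmetric] imageI)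
    then show ?thesis using sub T by (auto simp: subsemigroup_def Q')
  qed
  moreover have "\<exists>a\<in>(\<phi> \<circ> h) ` carrier S. \<exists>b\<in>(\<phi> \<circ> h) ` carrier S. q = sg_inv Q' a \<cdot>\<^bsub>Q'\<^esub> b"
    if q: "q \<in> carrier Q'" for q
  proof -
    obtain p where p: "p \<in> carrier Q" "q = \<phi> p" using q by (auto simp: Q')
    then obtain a b where "a \<in> carrier S" "b \<in> carrier S" "p = sg_inv Q (h a) \<cdot>\<^bsub>Q\<^esub> h b"
      using h(2) unfolding I_order_def left_I_order_def by blast
    then show ?thesis using p T by (auto simp: inv mult intro!: bexI)
  qed
  moreover have "\<exists>a\<in>(\<phi> \<circ> h) ` carrier S. \<exists>b\<in>(\<phi> \<circ> h) ` carrier S. q = a \<cdot>\<^bsub>Q'\<^esub> sg_inv Q' b"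
    if q: "q \<in> carrier Q'" for q
  proof -
    obtain p where p: "p \<in> carrier Q" "q = \<phi> p" using q by (auto simp: Q')
    then obtain a b where "a \<in> carrier S" "b \<in> carrier S" "p = h a \<cdot>\<^bsub>Q\<^esub> sg_inv Q (h b)"
      using h(2) unfolding I_order_def right_I_order_def by blast
    then show ?thesis using p T by (auto simp: inv mult intro!: bexI)
  qed
  ultimately show ?thesis
    unfolding is_I_order_in_def I_order_def left_I_order_def right_I_order_def by blast
qed

text \<open>Choose for every \<open>q\<close> one pair \<open>(a, b)\<close> with
  \<open>q = (h a)^-1 h b\<close>. The choice \<phi> is injective because the pair determines
  \<open>q\<close>, so the multiplication of \<open>Q\<close> can be moved to the chosen
  pairs.\<close>

lemma I_order_in_some_primitiveI:
  fixes S :: "('a, 'm) sgrp_scheme"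
  assumes Q: "primitive_inverse_semigroup Q" and "is_I_order_in S Q"
  shows "I_order_in_some_primitive S"
proof -
  obtain h where h: "I_order (h ` carrier S) Q"
    using assms unfolding is_I_order_in_def by blast
  have "\<forall>q\<in>carrier Q. \<exists>ab. q = sg_inv Q (h (fst ab)) \<cdot>\<^bsub>Q\<^esub> h (snd ab)"
  proof
    fix q assume "q \<in> carrier Q"
    then obtain a b where "q = sg_inv Q (h a) \<cdot>\<^bsub>Q\<^esub> h b"
      using h unfolding I_order_def left_I_order_def by blast
    then show "\<exists>ab. q = sg_inv Q (h (fst ab)) \<cdot>\<^bsub>Q\<^esub> h (snd ab)"
      by (intro exI[of _ "(a, b)"]) simp
  qed
  then obtain \<phi> :: "_ \<Rightarrow> 'a \<times> 'a"
    where \<phi>: "\<And>q. q \<in> carrier Q \<Longrightarrow> q = sg_inv Q (h (fst (\<phi> q))) \<cdot>\<^bsub>Q\<^esub> h (snd (\<phi> q))"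
    by metis
  have inj: "inj_on \<phi> (carrier Q)" by (rule inj_onI) (metis \<phi>)
  define Q' :: "('a \<times> 'a) sgrp" where
    "Q' = \<lparr>carrier = \<phi> ` carrier Q,
      sg_mult = (\<lambda>x y. \<phi> (the_inv_into (carrier Q) \<phi> x \<cdot>\<^bsub>Q\<^esub> the_inv_into (carrier Q) \<phi> y))\<rparr>"
  have Q': "carrier Q' = \<phi> ` carrier Q"
    "\<And>x y. \<lbrakk>x \<in> carrier Q; y \<in> carrier Q\<rbrakk> \<Longrightarrow> \<phi> x \<cdot>\<^bsub>Q'\<^esub> \<phi> y = \<phi> (x \<cdot>\<^bsub>Q\<^esub> y)"
    by (simp_all add: Q'_def the_inv_into_f_f[OF inj])
  show ?thesis
    unfolding I_order_in_some_primitive_def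
  proof (intro exI conjI)
    show "primitive_inverse_semigroup Q'"
      by (rule primitive_inverse_semigroup_isomorphic[OF Q inj Q'])
    show "is_I_order_in S Q'"
      by (rule is_I_order_in_isomorphic[OF Q inj Q' assms(2)])
  qed
qed


subsection \<open>The semigroup of fractions\<close>

locale fraction_semigroup = categorical_cancellative +
  assumes transp_lambda: "transp_on (carrier S) (lambda_rel S z)"
    and transp_rho: "transp_on (carrier S) (rho_rel S z)"
begin

text \<open>The pair \<open>(a, b)\<close> stands for the nonzero fraction \<open>a\<^sup>-\<^sup>1b\<close>.\<close>

definition fpairs where
  "fpairs = {(a, b). a \<in> carrier S \<and> b \<in> carrier S \<and> (\<exists>x\<in>carrier S. x \<cdot> a \<noteq> z \<and> x \<cdot> b \<noteq> z)}"

definition feq where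
  "feq = {((a, b), (c, d)). (a, b) \<in> fpairs \<and> (c, d) \<in> fpairs \<and>
    (\<exists>x\<in>carrier S. \<exists>y\<in>carrier S. x \<cdot> a = y \<cdot> c \<and> x \<cdot> b = y \<cdot> d \<and> x \<cdot> a \<noteq> z)}"

text \<open>Zero is the empty set. A nonempty relational product of two classes need not be a full class,
  hence the closure under \<^const>\<open>feq\<close>.\<close>

definition frac where
  "frac = \<lparr>carrier = insert {} (fpairs // feq), sg_mult = (\<lambda>p q. feq `` (p O q))\<rparr>"

definition cls where
  "cls a b = feq `` {(a, b)}"

definition emb where
  "emb c = {(x, x \<cdot> c) | x. x \<in> carrier S \<and> x \<cdot> c \<noteq> z}"

section \<open>Fraction pairs and their equivalence\<close>

lemma fpairs_closed:
  assumes "(a, b) \<in> fpairs" shows "a \<in> carrier S" "b \<in> carrier S"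
  using assms by (simp_all add: fpairs_def)

text \<open>The condition in \<open>fpairs\<close> is the existential side of (E); it excludes zero
  entries.\<close>

lemma fpairs_rho: "(a, b) \<in> fpairs \<Longrightarrow> rho_rel S z a b"
  using cond_E_if_transp[OF transp_rho] unfolding cond_E_def fpairs_def by blast

lemma fpairs_sym: "(a, b) \<in> fpairs \<Longrightarrow> (b, a) \<in> fpairs"
  unfolding fpairs_def by auto

lemma fpairs_mult_nonzero_iff:
  assumes "(a, b) \<in> fpairs" "y \<in> carrier S"
  shows "y \<cdot> a \<noteq> z \<longleftrightarrow> y \<cdot> b \<noteq> z"
  using rho_mult_nonzero fpairs_rho fpairs_sym fpairs_closed assms by metis

lemma fpairs_trans:
  assumes "(a, b) \<in> fpairs" "(b, c) \<in> fpairs"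
  shows "(a, c) \<in> fpairs"
  using assms fpairs_mult_nonzero_iff[OF assms(2)] unfolding fpairs_def by blast

lemma fpairs_refl: "(a, b) \<in> fpairs \<Longrightarrow> (a, a) \<in> fpairs"
  using fpairs_trans fpairs_sym by blast

text \<open>The element \<open>a\<close> is the common right multiplier that (E') asks for, so
  \<open>x\<close> \<lambda> \<open>y\<close>. This plays the part of an Ore condition.\<close>

lemma common_left_multiple:
  assumes mem: "x \<in> carrier S" "y \<in> carrier S" "a \<in> carrier S" and nz: "x \<cdot> a \<noteq> z" "y \<cdot> a \<noteq> z"
  obtains p q where "p \<in> carrier S" "q \<in> carrier S" "p \<cdot> x = q \<cdot> y" "p \<cdot> x \<noteq> z"
proof -
  have "lambda_rel S z x y"
    using cond_E'_if_transp[OF transp_lambda] mem nz unfolding cond_E'_def by blast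
  moreover have "x \<noteq> z" using mult_nonzeroD nz(1) mem by blast
  ultimately show ?thesis using that mem unfolding lambda_rel_iff[OF mem(1,2)] by blast
qed

lemma feq_iff:
  "((a, b), (c, d)) \<in> feq \<longleftrightarrow> (a, b) \<in> fpairs \<and> (c, d) \<in> fpairs \<and>
    (\<exists>x\<in>carrier S. \<exists>y\<in>carrier S. x \<cdot> a = y \<cdot> c \<and> x \<cdot> b = y \<cdot> d \<and> x \<cdot> a \<noteq> z)"
  by (simp add: feq_def)

text \<open>Any pair of multipliers that matches the first entries in a nonzero value also matches
  the second ones. A common left multiple \<open>p \<cdot> x = q \<cdot> u\<close> compares the
  given multipliers with witnesses \<open>u\<close>, \<open>v\<close> of the equivalence: cancelling
  \<open>c\<close> gives \<open>p \<cdot> y = q \<cdot> v\<close>, and then \<open>p\<close> is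
  cancelled from \<open>p \<cdot> (x \<cdot> b) = p \<cdot> (y \<cdot> d)\<close>.\<close>

lemma feq_universal:
  assumes eq: "((a, b), (c, d)) \<in> feq"
    and xy: "x \<in> carrier S" "y \<in> carrier S" "x \<cdot> a = y \<cdot> c" "x \<cdot> a \<noteq> z"
  shows "x \<cdot> b = y \<cdot> d"
proof -
  obtain u v where ab: "(a, b) \<in> fpairs" and cd: "(c, d) \<in> fpairs"
    and uv: "u \<in> carrier S" "v \<in> carrier S" "u \<cdot> a = v \<cdot> c" "u \<cdot> b = v \<cdot> d" "u \<cdot> a \<noteq> z"
    using eq unfolding feq_iff by blast
  note mem = fpairs_closed[OF ab] fpairs_closed[OF cd]
  obtain p q where pq: "p \<in> carrier S" "q \<in> carrier S" "p \<cdot> x = q \<cdot> u" "p \<cdot> x \<noteq> z"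
    using common_left_multiple[of x u a] xy uv mem by blast
  have "p \<cdot> y \<cdot> c = p \<cdot> x \<cdot> a" using pq(1) xy mem by (simp add: assoc)
  also have "\<dots> = q \<cdot> u \<cdot> a" by (simp add: pq(3))
  also have "\<dots> = q \<cdot> v \<cdot> c" using pq(2) uv mem by (simp add: assoc)
  finally have pyc: "p \<cdot> y \<cdot> c = q \<cdot> v \<cdot> c" .
  have "p \<cdot> (x \<cdot> a) \<noteq> z" using mult3_nonzero[OF pq(4) xy(4)] pq xy mem by blast
  then have "p \<cdot> y \<cdot> c \<noteq> z" using pq(1) xy mem by (simp add: assoc)
  then have py: "p \<cdot> y = q \<cdot> v"
    using right_cancel[OF pyc] pq xy uv mem closed by blast
  have xb: "x \<cdot> b \<noteq> z" using fpairs_mult_nonzero_iff[OF ab] xy by blast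
  then have "p \<cdot> (x \<cdot> b) \<noteq> z" using mult3_nonzero pq xy mem by blast
  moreover have "p \<cdot> (x \<cdot> b) = p \<cdot> (y \<cdot> d)"
  proof -
    have "p \<cdot> (x \<cdot> b) = q \<cdot> u \<cdot> b" using pq xy mem by (simp flip: assoc)
    also have "\<dots> = q \<cdot> v \<cdot> d" using pq(2) uv mem by (simp add: assoc)
    also have "\<dots> = p \<cdot> y \<cdot> d" by (simp add: py)
    also have "\<dots> = p \<cdot> (y \<cdot> d)" using pq(1) xy(2) mem by (simp add: assoc)
    finally show ?thesis .
  qed
  ultimately show ?thesis using left_cancel[of p] pq xy mem closed by blast
qed

lemma feq_refl: "(a, b) \<in> fpairs \<Longrightarrow> ((a, b), (a, b)) \<in> feq"
  unfolding feq_iff by (auto simp: fpairs_def)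

lemma feq_sym: "((a, b), (c, d)) \<in> feq \<Longrightarrow> ((c, d), (a, b)) \<in> feq"
  unfolding feq_iff by metis

lemma feq_inverse: "((a, b), (c, d)) \<in> feq \<Longrightarrow> ((b, a), (d, c)) \<in> feq"
  unfolding feq_iff using fpairs_sym fpairs_mult_nonzero_iff by metis

text \<open>The multipliers witnessing the first equivalence match \<open>b\<close> with
  \<open>b'\<close>, so \<open>feq_universal\<close> lets them serve for the second one too.\<close>

lemma feq_comp:
  assumes "((a, b), (a', b')) \<in> feq" and bc: "((b, c), (b', c')) \<in> feq"
  shows "((a, c), (a', c')) \<in> feq"
proof -
  obtain x y where ab: "(a, b) \<in> fpairs" "(a', b') \<in> fpairs"
    and xy: "x \<in> carrier S" "y \<in> carrier S" "x \<cdot> a = y \<cdot> a'" "x \<cdot> b = y \<cdot> b'" "x \<cdot> a \<noteq> z"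
    using assms(1) unfolding feq_iff by blast
  have "x \<cdot> b \<noteq> z" using fpairs_mult_nonzero_iff ab(1) xy by blast
  then have "x \<cdot> c = y \<cdot> c'" using feq_universal[OF bc] xy by blast
  moreover have "(b, c) \<in> fpairs" "(b', c') \<in> fpairs" using bc unfolding feq_iff by blast+
  ultimately show ?thesis unfolding feq_iff using ab xy fpairs_trans by blast
qed

text \<open>A common left multiple \<open>p \<cdot> y = q \<cdot> v\<close> of the two multipliers
  acting on \<open>(c, d)\<close> joins the witnesses; the new ones are \<open>p \<cdot> x\<close>
  and \<open>q \<cdot> w\<close>.\<close>

lemma feq_trans:
  assumes "((a, b), (c, d)) \<in> feq" "((c, d), (e, f)) \<in> feq"
  shows "((a, b), (e, f)) \<in> feq"
proof -
  obtain x y where ab: "(a, b) \<in> fpairs" and cd: "(c, d) \<in> fpairs"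
    and xy: "x \<in> carrier S" "y \<in> carrier S" "x \<cdot> a = y \<cdot> c" "x \<cdot> b = y \<cdot> d" "x \<cdot> a \<noteq> z"
    using assms(1) unfolding feq_iff by blast
  obtain v w where ef: "(e, f) \<in> fpairs"
    and vw: "v \<in> carrier S" "w \<in> carrier S" "v \<cdot> c = w \<cdot> e" "v \<cdot> d = w \<cdot> f" "v \<cdot> c \<noteq> z"
    using assms(2) unfolding feq_iff by blast
  note mem = fpairs_closed[OF ab] fpairs_closed[OF cd] fpairs_closed[OF ef]
  have "y \<cdot> c \<noteq> z" using xy by simp
  then obtain p q where pq: "p \<in> carrier S" "q \<in> carrier S" "p \<cdot> y = q \<cdot> v" "p \<cdot> y \<noteq> z"
    using common_left_multiple[of y v c] xy vw mem by blast
  have "p \<cdot> (y \<cdot> c) \<noteq> z" using mult3_nonzero[OF pq(4) \<open>y \<cdot> c \<noteq> z\<close>] pq xy mem by blast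
  have chain: "p \<cdot> x \<cdot> s = q \<cdot> w \<cdot> t"
    if "x \<cdot> s = y \<cdot> r" "v \<cdot> r = w \<cdot> t" "s \<in> carrier S" "r \<in> carrier S" "t \<in> carrier S" for s r t
  proof -
    have "p \<cdot> x \<cdot> s = p \<cdot> y \<cdot> r" using pq(1) xy(1,2) that by (simp add: assoc)
    also have "\<dots> = q \<cdot> v \<cdot> r" by (simp add: pq(3))
    also have "\<dots> = q \<cdot> (v \<cdot> r)" using pq(2) vw(1) that by (simp add: assoc)
    also have "\<dots> = q \<cdot> w \<cdot> t" using pq(2) vw(2) that by (simp add: assoc)
    finally show ?thesis .
  qed
  have "p \<cdot> x \<cdot> a \<noteq> z" using \<open>p \<cdot> (y \<cdot> c) \<noteq> z\<close> pq(1) xy(1,3) mem by (simp add: assoc)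
  moreover have "p \<cdot> x \<cdot> a = q \<cdot> w \<cdot> e" "p \<cdot> x \<cdot> b = q \<cdot> w \<cdot> f"
    using chain xy(3,4) vw(3,4) mem by blast+
  moreover have "p \<cdot> x \<in> carrier S" "q \<cdot> w \<in> carrier S"
    using pq(1,2) xy(1) vw(2) closed by blast+
  ultimately show ?thesis unfolding feq_iff using ab ef by blast
qed

lemma equiv_feq: "equiv fpairs feq"
proof (rule equivI)
  show "feq \<subseteq> fpairs \<times> fpairs" by (auto simp: feq_def)
  show "refl_on fpairs feq" by (rule refl_onI) (auto simp: feq_refl)
  show "sym feq" by (rule symI) (auto intro: feq_sym)
  show "trans feq" by (rule transI) (auto intro: feq_trans)
qed

section \<open>Classes of pairs and their products\<close>

lemma cls_eq_iff:
  "\<lbrakk>(a, b) \<in> fpairs; (c, d) \<in> fpairs\<rbrakk> \<Longrightarrow> cls a b = cls c d \<longleftrightarrow> ((a, b), (c, d)) \<in> feq"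
  unfolding cls_def by (rule eq_equiv_class_iff[OF equiv_feq])

lemma mem_cls_iff: "(c, d) \<in> cls a b \<longleftrightarrow> ((a, b), (c, d)) \<in> feq"
  by (simp add: cls_def)

lemma mem_cls_self: "(a, b) \<in> fpairs \<Longrightarrow> (a, b) \<in> cls a b"
  by (simp add: mem_cls_iff feq_refl)

lemma cls_eqI: "(c, d) \<in> cls a b \<Longrightarrow> (c, d) \<in> fpairs \<and> cls a b = cls c d"
  using cls_eq_iff unfolding mem_cls_iff feq_iff by blast

lemma frac_carrier: "p \<in> carrier frac \<longleftrightarrow> p = {} \<or> (\<exists>a b. (a, b) \<in> fpairs \<and> p = cls a b)"
  by (auto simp: frac_def quotient_def cls_def)

lemma frac_mult: "p \<cdot>\<^bsub>frac\<^esub> q = feq `` (p O q)"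
  by (simp add: frac_def)

lemma frac_mult_empty [simp]: "{} \<cdot>\<^bsub>frac\<^esub> q = {}" "p \<cdot>\<^bsub>frac\<^esub> {} = {}"
  by (simp_all add: frac_mult)

lemma Image_cls: "feq `` cls a b = cls a b"
proof (intro equalityI subrelI)
  show "(c, d) \<in> cls a b" if "(c, d) \<in> feq `` cls a b" for c d
    using that by (auto simp: mem_cls_iff intro: feq_trans)
  show "(c, d) \<in> feq `` cls a b" if "(c, d) \<in> cls a b" for c d
    using that cls_eqI feq_refl by blast
qed

text \<open>By \<open>feq_comp\<close> the relational product stays inside \<open>cls a c\<close>,
  and it contains \<open>(a, c)\<close>; closing under \<open>feq\<close> therefore gives the whole
  class.\<close>

lemma cls_mult:
  assumes "(a, b) \<in> fpairs" "(b, c) \<in> fpairs"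
  shows "cls a b \<cdot>\<^bsub>frac\<^esub> cls b c = cls a c"
proof -
  have ac: "(a, c) \<in> fpairs" using fpairs_trans assms .
  have "(a, c) \<in> cls a b O cls b c" using mem_cls_self assms by blast
  then have "cls a c \<subseteq> feq `` (cls a b O cls b c)" unfolding cls_def by blast
  moreover have "cls a b O cls b c \<subseteq> cls a c" by (auto simp: mem_cls_iff intro: feq_comp)
  then have "feq `` (cls a b O cls b c) \<subseteq> feq `` cls a c" by (rule Image_mono[OF subset_refl])
  ultimately show ?thesis unfolding frac_mult Image_cls by blast
qed

text \<open>A point of the relational product is a pair from \<open>p\<close> and a pair from
  \<open>q\<close> with the same middle entry; these serve as representatives, so
  \<open>cls_mult\<close> applies.\<close>

lemma frac_mult_nonempty:
  assumes p: "p \<in> carrier frac" and q: "q \<in> carrier frac" and ne: "p \<cdot>\<^bsub>frac\<^esub> q \<noteq> {}"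
  obtains a b c where "(a, b) \<in> fpairs" "(b, c) \<in> fpairs" "p = cls a b" "q = cls b c"
    "p \<cdot>\<^bsub>frac\<^esub> q = cls a c"
proof -
  have "p O q \<noteq> {}" using ne unfolding frac_mult by blast
  then obtain a b c where "(a, b) \<in> p" "(b, c) \<in> q" by auto
  then have "(a, b) \<in> fpairs \<and> p = cls a b" "(b, c) \<in> fpairs \<and> q = cls b c"
    using p q cls_eqI unfolding frac_carrier by blast+
  then show ?thesis using that cls_mult by blast
qed

text \<open>A fraction may be expanded by a left factor that does not kill it:
  \<open>w \<cdot> x\<close> on \<open>(a, b)\<close> and \<open>w\<close> on the expanded pair
  witness the equivalence, for any \<open>w\<close> with
  \<open>w \<cdot> (x \<cdot> a) \<noteq> z\<close>.\<close>

lemma cls_scale: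
  assumes ab: "(a, b) \<in> fpairs" and x: "x \<in> carrier S" "x \<cdot> a \<noteq> z"
  shows "(x \<cdot> a, x \<cdot> b) \<in> fpairs" "cls a b = cls (x \<cdot> a) (x \<cdot> b)"
proof -
  note mem = fpairs_closed[OF ab]
  have xb: "x \<cdot> b \<noteq> z" using fpairs_mult_nonzero_iff[OF ab] x by blast
  obtain w where w: "w \<in> carrier S" "w \<cdot> (x \<cdot> a) \<noteq> z"
    using exists_left x mem closed by metis
  have wx: "w \<cdot> x \<in> carrier S" "w \<cdot> x \<cdot> a = w \<cdot> (x \<cdot> a)" "w \<cdot> x \<cdot> b = w \<cdot> (x \<cdot> b)"
    using w x mem by (simp_all add: closed assoc)
  then have "w \<cdot> (x \<cdot> b) \<noteq> z" using fpairs_mult_nonzero_iff[OF ab wx(1)] w by simp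
  then show *: "(x \<cdot> a, x \<cdot> b) \<in> fpairs" using w x mem closed unfolding fpairs_def by blast
  have "((a, b), (x \<cdot> a, x \<cdot> b)) \<in> feq" unfolding feq_iff using ab * w wx by metis
  then show "cls a b = cls (x \<cdot> a) (x \<cdot> b)" using cls_eq_iff ab * by blast
qed

lemma cls_common_scale:
  assumes "(a, b) \<in> fpairs" "(c, d) \<in> fpairs" "cls a b = cls c d"
  obtains x y where "x \<in> carrier S" "y \<in> carrier S" "x \<cdot> a = y \<cdot> c" "x \<cdot> b = y \<cdot> d" "x \<cdot> a \<noteq> z"
    "x \<cdot> b \<noteq> z"
  using assms cls_eq_iff fpairs_mult_nonzero_iff unfolding feq_iff by metis

text \<open>With the same first entry, the two multipliers coincide by right cancellation, and left
  cancellation then identifies the second entries.\<close>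

lemma cls_left_eqD:
  assumes ab: "(a, b) \<in> fpairs" and ac: "(a, c) \<in> fpairs" and eq: "cls a b = cls a c"
  shows "b = c"
proof -
  obtain x y where xy: "x \<in> carrier S" "y \<in> carrier S" "x \<cdot> a = y \<cdot> a" "x \<cdot> b = y \<cdot> c"
      "x \<cdot> a \<noteq> z" "x \<cdot> b \<noteq> z"
    using cls_common_scale[OF ab ac eq] .
  note mem = fpairs_closed[OF ab] fpairs_closed[OF ac]
  have "x = y" using right_cancel[of x a y] xy mem by blast
  then show ?thesis using left_cancel[of x b c] xy mem by blast
qed

lemma converse_cls: "(cls a b)\<inverse> = cls b a"
  by (auto simp: mem_cls_iff intro: feq_inverse)

lemma cls_right_eqD:
  assumes "(a, c) \<in> fpairs" "(b, c) \<in> fpairs" "cls a c = cls b c"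
  shows "a = b"
proof (rule cls_left_eqD)
  show "(c, a) \<in> fpairs" "(c, b) \<in> fpairs" using assms fpairs_sym by blast+
  show "cls c a = cls c b" using assms(3) converse_cls by metis
qed

text \<open>If either bracketing is nonzero, the three factors have representatives forming one
  chain. Both bracketings then evaluate to \<open>cls a d\<close>, which is how associativity is
  obtained.\<close>

lemma frac_mult3_nonempty:
  assumes mem: "p \<in> carrier frac" "q \<in> carrier frac" "r \<in> carrier frac"
    and ne: "p \<cdot>\<^bsub>frac\<^esub> q \<cdot>\<^bsub>frac\<^esub> r \<noteq> {} \<or> p \<cdot>\<^bsub>frac\<^esub> (q \<cdot>\<^bsub>frac\<^esub> r) \<noteq> {}"
  obtains a b c d where "(a, b) \<in> fpairs" "(b, c) \<in> fpairs" "(c, d) \<in> fpairs"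
    "p = cls a b" "q = cls b c" "r = cls c d"
  using ne
proof
  assume ne: "p \<cdot>\<^bsub>frac\<^esub> q \<cdot>\<^bsub>frac\<^esub> r \<noteq> {}"
  then have "p \<cdot>\<^bsub>frac\<^esub> q \<noteq> {}" by auto
  then obtain a b c where ab: "(a, b) \<in> fpairs" "p = cls a b" and bc: "(b, c) \<in> fpairs" "q = cls b c"
    and pq: "p \<cdot>\<^bsub>frac\<^esub> q = cls a c"
    using frac_mult_nonempty mem by metis
  have ac: "(a, c) \<in> fpairs" using fpairs_trans ab bc by blast
  then have "cls a c \<in> carrier frac" using frac_carrier by blast
  then obtain u v w where uv: "(u, v) \<in> fpairs" "cls a c = cls u v"
    and vw: "(v, w) \<in> fpairs" "r = cls v w"
    using frac_mult_nonempty[of "cls a c" r] ne mem unfolding pq by metis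
  \<comment> \<open>Expanding the chain \<open>a\<close>, \<open>b\<close>, \<open>c\<close> by
    \<open>x\<close> and the pair \<open>v\<close>, \<open>w\<close> by \<open>y\<close> makes them
    meet in \<open>x \<cdot> c = y \<cdot> v\<close>.\<close>
  obtain x y where x: "x \<in> carrier S" "x \<cdot> a \<noteq> z" "x \<cdot> c \<noteq> z" and y: "y \<in> carrier S" "x \<cdot> c = y \<cdot> v"
    using cls_common_scale[OF ac uv] by metis
  have "x \<cdot> b \<noteq> z" using fpairs_mult_nonzero_iff ab(1) x by blast
  moreover have "y \<cdot> v \<noteq> z" using x y by simp
  ultimately show ?thesis
    using that[of "x \<cdot> a" "x \<cdot> b" "x \<cdot> c" "y \<cdot> w"] cls_scale ab bc vw x y by metis
next
  assume ne: "p \<cdot>\<^bsub>frac\<^esub> (q \<cdot>\<^bsub>frac\<^esub> r) \<noteq> {}"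
  then have "q \<cdot>\<^bsub>frac\<^esub> r \<noteq> {}" by auto
  then obtain b c d where bc: "(b, c) \<in> fpairs" "q = cls b c" and cd: "(c, d) \<in> fpairs" "r = cls c d"
    and qr: "q \<cdot>\<^bsub>frac\<^esub> r = cls b d"
    using frac_mult_nonempty mem by metis
  have bd: "(b, d) \<in> fpairs" using fpairs_trans bc cd by blast
  then have "cls b d \<in> carrier frac" using frac_carrier by blast
  then obtain u v w where uv: "(u, v) \<in> fpairs" "p = cls u v"
    and vw: "(v, w) \<in> fpairs" "cls b d = cls v w"
    using frac_mult_nonempty[of p "cls b d"] ne mem unfolding qr by metis
  obtain x y where x: "x \<in> carrier S" "x \<cdot> b \<noteq> z" and y: "y \<in> carrier S" "x \<cdot> b = y \<cdot> v"
    using cls_common_scale[OF bd vw] by metis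
  have "x \<cdot> c \<noteq> z" using fpairs_mult_nonzero_iff bc(1) x by blast
  moreover have "y \<cdot> v \<noteq> z" using x y by simp
  then have "y \<cdot> u \<noteq> z" using fpairs_mult_nonzero_iff uv(1) y by blast
  ultimately show ?thesis
    using that[of "y \<cdot> u" "x \<cdot> b" "x \<cdot> c" "x \<cdot> d"] cls_scale bc cd uv x y by metis
qed

lemma frac_closed: "\<lbrakk>p \<in> carrier frac; q \<in> carrier frac\<rbrakk> \<Longrightarrow> p \<cdot>\<^bsub>frac\<^esub> q \<in> carrier frac"
  using frac_mult_nonempty fpairs_trans frac_carrier by metis

section \<open>Fractions form a primitive inverse semigroup\<close>

lemma carrier_semigroup_frac: "carrier_semigroup frac"
proof
  fix p q r assume mem: "p \<in> carrier frac" "q \<in> carrier frac" "r \<in> carrier frac"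
  show "p \<cdot>\<^bsub>frac\<^esub> q \<cdot>\<^bsub>frac\<^esub> r = p \<cdot>\<^bsub>frac\<^esub> (q \<cdot>\<^bsub>frac\<^esub> r)"
  proof (cases "p \<cdot>\<^bsub>frac\<^esub> q \<cdot>\<^bsub>frac\<^esub> r = {} \<and> p \<cdot>\<^bsub>frac\<^esub> (q \<cdot>\<^bsub>frac\<^esub> r) = {}")
    case False
    then have "p \<cdot>\<^bsub>frac\<^esub> q \<cdot>\<^bsub>frac\<^esub> r \<noteq> {} \<or> p \<cdot>\<^bsub>frac\<^esub> (q \<cdot>\<^bsub>frac\<^esub> r) \<noteq> {}" by blast
    then obtain a b c d where "(a, b) \<in> fpairs" "(b, c) \<in> fpairs" "(c, d) \<in> fpairs"
      "p = cls a b" "q = cls b c" "r = cls c d"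
      using frac_mult3_nonempty[OF mem] by metis
    then show ?thesis by (simp add: cls_mult fpairs_trans[of a b c] fpairs_trans[of b c d])
  qed simp
next
  show "carrier frac \<noteq> {}" using frac_carrier by blast
qed (rule frac_closed)

lemma converse_closed: "p \<in> carrier frac \<Longrightarrow> p\<inverse> \<in> carrier frac"
  using converse_cls fpairs_sym unfolding frac_carrier by (metis converse_empty)

text \<open>For nonzero \<open>p\<close>, the product \<open>p q p\<close> yields a chain with
  \<open>p = cls a b = cls c d\<close> and \<open>q = cls b c\<close>. The product is
  \<open>cls a d\<close>, so \<open>cls c d = cls a d\<close> forces \<open>c = a\<close>, and
  \<open>q\<close> is the converse \<open>cls b a\<close>. Existence and uniqueness of inverses
  follow together.\<close>

lemma frac_is_inverse_of_iff:
  assumes p: "p \<in> carrier frac"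
  shows "is_inverse_of frac p q \<longleftrightarrow> q = p\<inverse>"
proof
  assume inv: "is_inverse_of frac p q"
  then have q: "q \<in> carrier frac" and pqp: "p \<cdot>\<^bsub>frac\<^esub> q \<cdot>\<^bsub>frac\<^esub> p = p"
    and qpq: "q \<cdot>\<^bsub>frac\<^esub> p \<cdot>\<^bsub>frac\<^esub> q = q"
    by (simp_all add: is_inverse_of_def)
  show "q = p\<inverse>"
  proof (cases "p = {}")
    case True
    then show ?thesis using qpq by simp
  next
    case False
    then obtain a b c d where ab: "(a, b) \<in> fpairs" and bc: "(b, c) \<in> fpairs" and cd: "(c, d) \<in> fpairs"
      and eq: "p = cls a b" "q = cls b c" "p = cls c d"
      using frac_mult3_nonempty[OF p q p] pqp by metis
    have ac: "(a, c) \<in> fpairs" and ad: "(a, d) \<in> fpairs" using ab bc cd fpairs_trans by blast+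
    have "p \<cdot>\<^bsub>frac\<^esub> q \<cdot>\<^bsub>frac\<^esub> p = cls a d"
      using cls_mult[OF ab bc] cls_mult[OF ac cd] eq by metis
    then have "cls c d = cls a d" using pqp eq by simp
    then have "c = a" using cls_right_eqD cd ad by blast
    then show ?thesis using eq converse_cls by simp
  qed
next
  assume q: "q = p\<inverse>"
  show "is_inverse_of frac p q"
  proof (cases "p = {}")
    case True
    then show ?thesis using q by (simp add: is_inverse_of_def frac_carrier)
  next
    case False
    then obtain a b where ab: "(a, b) \<in> fpairs" "p = cls a b" using p frac_carrier by blast
    then have "q = cls b a" using q converse_cls by simp
    moreover have "(b, a) \<in> fpairs" "(a, a) \<in> fpairs" "(b, b) \<in> fpairs"
      using ab fpairs_sym fpairs_refl by blast+
    ultimately show ?thesis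
      using ab converse_closed[OF p] q by (simp add: is_inverse_of_def cls_mult)
  qed
qed

lemma inverse_semigroup_frac: "inverse_semigroup frac"
proof -
  interpret frac: carrier_semigroup frac by (rule carrier_semigroup_frac)
  show ?thesis by unfold_locales (simp add: frac_is_inverse_of_iff)
qed

lemma sg_inv_frac: "p \<in> carrier frac \<Longrightarrow> sg_inv frac p = p\<inverse>"
  by (simp add: sg_inv_def frac_is_inverse_of_iff)

text \<open>A nonzero idempotent is at once \<open>cls a b\<close>, \<open>cls b c\<close> and
  \<open>cls a c\<close>, so \<open>a = b\<close> by \<open>cls_right_eqD\<close>. Every pair
  \<open>(u, v)\<close> equivalent to \<open>(a, a)\<close> satisfies
  \<open>y \<cdot> u = y \<cdot> v\<close> with a nonzero value, and \<open>y\<close>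
  cancels.\<close>

lemma frac_idempotent_diagonal:
  assumes e: "e \<in> idempotents frac" and uv: "(u, v) \<in> e"
  shows "u = v"
proof -
  have e': "e \<in> carrier frac" "e \<cdot>\<^bsub>frac\<^esub> e = e" using e by (simp_all add: idempotents_def)
  then obtain a b c where ab: "(a, b) \<in> fpairs" and bc: "(b, c) \<in> fpairs"
    and eq: "e = cls a b" "e = cls b c" "e = cls a c"
    using frac_mult_nonempty[of e e] uv by (metis empty_iff)
  have ac: "(a, c) \<in> fpairs" using fpairs_trans ab bc .
  have "a = b" using cls_right_eqD[OF ac bc] eq by simp
  then have "((a, a), (u, v)) \<in> feq" using uv eq mem_cls_iff by metis
  then obtain x y where "x \<in> carrier S" "y \<in> carrier S" "x \<cdot> a = y \<cdot> u" "x \<cdot> a = y \<cdot> v" "x \<cdot> a \<noteq> z"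
    and "(u, v) \<in> fpairs"
    unfolding feq_iff by blast
  then show ?thesis using left_cancel[of y u v] fpairs_closed by metis
qed

lemma primitive_inverse_semigroup_frac: "primitive_inverse_semigroup frac"
  unfolding primitive_inverse_semigroup_def
proof (intro conjI inverse_semigroup_frac exI[of _ "{}"] ballI impI)
  show "is_zero frac {}" by (simp add: is_zero_def frac_carrier)
  fix e f
  assume e: "e \<in> idempotents frac" and f: "f \<in> idempotents frac"
    and ef: "e \<cdot>\<^bsub>frac\<^esub> f = f \<and> f \<cdot>\<^bsub>frac\<^esub> e = f"
  show "f = {} \<or> f = e"
  proof (rule disjCI)
    assume "f \<noteq> e"
    show "f = {}"
    proof (rule ccontr)
      assume "f \<noteq> {}"
      moreover have "e \<in> carrier frac" "f \<in> carrier frac" using e f by (simp_all add: idempotents_def)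
      \<comment> \<open>Representatives of \<open>e\<close> and \<open>f\<close> sharing the entry
        \<open>b\<close> are both diagonal, so \<open>e\<close> and \<open>f\<close> are the class
        of the same pair.\<close>
      ultimately obtain a b c where abc: "(a, b) \<in> fpairs" "(b, c) \<in> fpairs" "e = cls a b" "f = cls b c"
        using frac_mult_nonempty[of e f] ef by metis
      then have "a = b" "b = c" using frac_idempotent_diagonal e f mem_cls_self by blast+
      then show False using abc \<open>f \<noteq> e\<close> by simp
    qed
  qed
qed

section \<open>Embedding of \<open>S\<close> and quotients in \<open>frac\<close>\<close>

lemma emb_eq_cls:
  assumes "c \<in> carrier S" "x \<in> carrier S" "x \<cdot> c \<noteq> z"
  shows "(x, x \<cdot> c) \<in> fpairs" "emb c = cls x (x \<cdot> c)"
proof -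
  have pair: "(x, x \<cdot> c) \<in> fpairs" if x: "x \<in> carrier S" "x \<cdot> c \<noteq> z" for x
  proof -
    obtain w where w: "w \<in> carrier S" "w \<cdot> (x \<cdot> c) \<noteq> z"
      using exists_left x assms(1) closed by metis
    then have "w \<cdot> x \<cdot> c \<noteq> z" using x assms(1) by (simp add: assoc)
    then have "w \<cdot> x \<noteq> z" using mult_nonzeroD x w assms(1) closed by blast
    then show ?thesis using w x assms(1) closed unfolding fpairs_def by blast
  qed
  show *: "(x, x \<cdot> c) \<in> fpairs" using pair assms by blast
  \<comment> \<open>The element \<open>c\<close> is the fraction \<open>x^-1 (x c)\<close> for every
    \<open>x\<close> that does not kill it. In one direction, cancelling \<open>t\<close> from
    \<open>t \<cdot> v = t \<cdot> (u \<cdot> c)\<close> gives \<open>v = u \<cdot> c\<close>; in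
    the other, \<open>x\<close> and \<open>u\<close> have a common left multiple since neither kills
    \<open>c\<close>.\<close>
  have "(u, v) \<in> cls x (x \<cdot> c) \<longleftrightarrow> (u, v) \<in> emb c" for u v
  proof
    assume "(u, v) \<in> cls x (x \<cdot> c)"
    then obtain s t where uv: "(u, v) \<in> fpairs" and st: "s \<in> carrier S" "t \<in> carrier S"
        "s \<cdot> x = t \<cdot> u" "s \<cdot> (x \<cdot> c) = t \<cdot> v" "s \<cdot> x \<noteq> z"
      unfolding mem_cls_iff feq_iff by blast
    note mem = fpairs_closed[OF uv]
    have "t \<cdot> v = s \<cdot> x \<cdot> c" using st(1,4) assms by (simp add: assoc)
    also have "\<dots> = t \<cdot> u \<cdot> c" by (simp add: st(3))
    also have "\<dots> = t \<cdot> (u \<cdot> c)" using st(2) mem assms by (simp add: assoc)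
    finally have eq: "t \<cdot> v = t \<cdot> (u \<cdot> c)" .
    have tv: "t \<cdot> v \<noteq> z" using fpairs_mult_nonzero_iff[OF uv st(2)] st by simp
    then have "v = u \<cdot> c" using left_cancel[OF eq] st mem assms closed by blast
    moreover have "v \<noteq> z" using tv mult_nonzeroD st mem by blast
    ultimately show "(u, v) \<in> emb c" using mem unfolding emb_def by blast
  next
    assume "(u, v) \<in> emb c"
    then have uv: "u \<in> carrier S" "v = u \<cdot> c" "u \<cdot> c \<noteq> z" unfolding emb_def by auto
    obtain s t where st: "s \<in> carrier S" "t \<in> carrier S" "s \<cdot> x = t \<cdot> u" "s \<cdot> x \<noteq> z"
      using common_left_multiple[of x u c] assms uv by metis
    have "s \<cdot> (x \<cdot> c) = t \<cdot> v" using st assms uv by (simp flip: assoc)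
    then show "(u, v) \<in> cls x (x \<cdot> c)"
      unfolding mem_cls_iff feq_iff using * pair uv st by blast
  qed
  then show "emb c = cls x (x \<cdot> c)" by auto
qed

lemma emb_zero: "emb z = {}"
  by (auto simp: emb_def)

lemma emb_closed: "c \<in> carrier S \<Longrightarrow> emb c \<in> carrier frac"
  using emb_eq_cls emb_zero exists_left frac_carrier by metis

text \<open>The relational product already equals \<open>emb (c \<cdot> d)\<close>, and closing it
  under \<open>feq\<close> adds nothing because this set is empty or a full class.\<close>

lemma emb_mult:
  assumes c: "c \<in> carrier S" and d: "d \<in> carrier S"
  shows "emb (c \<cdot> d) = emb c \<cdot>\<^bsub>frac\<^esub> emb d"
proof -
  have "emb c O emb d = emb (c \<cdot> d)"
  proof (intro equalityI subrelI)
    fix u v assume "(u, v) \<in> emb c O emb d"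
    then show "(u, v) \<in> emb (c \<cdot> d)" using c d by (auto simp: emb_def assoc)
  next
    fix u v assume "(u, v) \<in> emb (c \<cdot> d)"
    then have u: "u \<in> carrier S" "v = u \<cdot> c \<cdot> d" "u \<cdot> c \<cdot> d \<noteq> z"
      using c d by (auto simp: emb_def assoc)
    then have "u \<cdot> c \<noteq> z" using mult_nonzeroD closed c d by blast
    then have "(u, u \<cdot> c) \<in> emb c" "(u \<cdot> c, v) \<in> emb d"
      using u closed c unfolding emb_def by blast+
    then show "(u, v) \<in> emb c O emb d" by blast
  qed
  moreover have "feq `` emb (c \<cdot> d) = emb (c \<cdot> d)"
  proof (cases "c \<cdot> d = z")
    case False
    then obtain x where "x \<in> carrier S" "x \<cdot> (c \<cdot> d) \<noteq> z" using exists_left c d closed by metis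
    then have "emb (c \<cdot> d) = cls x (x \<cdot> (c \<cdot> d))" using emb_eq_cls c d closed by blast
    then show ?thesis by (simp add: Image_cls)
  qed (simp add: emb_zero)
  ultimately show ?thesis by (simp add: frac_mult)
qed

lemma inj_on_emb: "inj_on emb (carrier S)"
proof -
  have "c = d" if hyps: "c \<in> carrier S" "d \<in> carrier S" "emb c = emb d" "c \<noteq> z" for c d
  proof -
    obtain x where x: "x \<in> carrier S" "x \<cdot> c \<noteq> z" using exists_left hyps by metis
    then have "(x, x \<cdot> c) \<in> emb c" by (simp add: emb_def)
    then have "(x, x \<cdot> c) \<in> emb d" by (simp only: hyps(3))
    then have "x \<cdot> c = x \<cdot> d" by (simp add: emb_def)
    then show ?thesis using left_cancel x hyps by blast
  qed
  \<comment> \<open>Of two distinct elements at least one is nonzero, and the claim applies with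
    that one as \<open>c\<close>.\<close>
  then show ?thesis unfolding inj_on_def by metis
qed

text \<open>Expand \<open>cls a b\<close> to \<open>cls (x \<cdot> a) (x \<cdot> b)\<close> and
  split it at \<open>x\<close>: the factors are \<open>cls (x \<cdot> a) x\<close>, the inverse of
  \<open>emb a\<close>, and \<open>cls x (x \<cdot> b)\<close>, which is
  \<open>emb b\<close>.\<close>

lemma frac_left_quotient:
  assumes "q \<in> carrier frac"
  shows "\<exists>a\<in>carrier S. \<exists>b\<in>carrier S. q = sg_inv frac (emb a) \<cdot>\<^bsub>frac\<^esub> emb b"
proof (cases "q = {}")
  case True
  then have "q = sg_inv frac (emb z) \<cdot>\<^bsub>frac\<^esub> emb z" by (simp add: emb_zero)
  then show ?thesis using zero_closed by blast
next
  case False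
  then obtain a b where ab: "(a, b) \<in> fpairs" "q = cls a b" using assms frac_carrier by blast
  note mem = fpairs_closed[OF ab(1)]
  obtain x where x: "x \<in> carrier S" "x \<cdot> a \<noteq> z" "x \<cdot> b \<noteq> z" using ab unfolding fpairs_def by blast
  have "sg_inv frac (emb a) = cls (x \<cdot> a) x"
    using emb_eq_cls x mem sg_inv_frac emb_closed converse_cls by metis
  moreover have "emb b = cls x (x \<cdot> b)" "(x, x \<cdot> b) \<in> fpairs" "(x \<cdot> a, x) \<in> fpairs"
    using emb_eq_cls fpairs_sym x mem by blast+
  moreover have "q = cls (x \<cdot> a) (x \<cdot> b)" using cls_scale ab x by blast
  ultimately have "q = sg_inv frac (emb a) \<cdot>\<^bsub>frac\<^esub> emb b" by (simp add: cls_mult)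
  then show ?thesis using mem by blast
qed

text \<open>Here \<rho> provides \<open>a \<cdot> u = b \<cdot> v\<close> nonzero. Splitting
  \<open>cls a b\<close> at this element gives \<open>cls a (a \<cdot> u)\<close>, which is
  \<open>emb u\<close>, and \<open>cls (b \<cdot> v) b\<close>, the inverse of
  \<open>emb v\<close>.\<close>

lemma frac_right_quotient:
  assumes "q \<in> carrier frac"
  shows "\<exists>a\<in>carrier S. \<exists>b\<in>carrier S. q = emb a \<cdot>\<^bsub>frac\<^esub> sg_inv frac (emb b)"
proof (cases "q = {}")
  case True
  then have "q = emb z \<cdot>\<^bsub>frac\<^esub> sg_inv frac (emb z)" by (simp add: emb_zero)
  then show ?thesis using zero_closed by blast
next
  case False
  then obtain a b where ab: "(a, b) \<in> fpairs" "q = cls a b" using assms frac_carrier by blast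
  note mem = fpairs_closed[OF ab(1)]
  have "a \<noteq> z" using ab(1) unfolding fpairs_def by auto
  then obtain u v where uv: "u \<in> carrier S" "v \<in> carrier S" "a \<cdot> u = b \<cdot> v" "a \<cdot> u \<noteq> z"
    using fpairs_rho[OF ab(1)] unfolding rho_rel_iff[OF mem] by blast
  have "sg_inv frac (emb v) = cls (b \<cdot> v) b"
    using emb_eq_cls uv mem sg_inv_frac emb_closed converse_cls by metis
  then have "sg_inv frac (emb v) = cls (a \<cdot> u) b" by (simp add: uv(3))
  moreover have "emb u = cls a (a \<cdot> u)" "(a, a \<cdot> u) \<in> fpairs"
    using emb_eq_cls uv mem by blast+
  moreover have "(a \<cdot> u, b) \<in> fpairs" using emb_eq_cls(1)[of v b] fpairs_sym uv mem by metis
  ultimately have "q = emb u \<cdot>\<^bsub>frac\<^esub> sg_inv frac (emb v)" using ab by (simp add: cls_mult)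
  then show ?thesis using uv by blast
qed

lemma is_I_order_in_frac: "is_I_order_in S frac"
proof -
  have "sg_embedding emb S frac"
    unfolding sg_embedding_def using emb_closed inj_on_emb emb_mult by blast
  moreover have "subsemigroup (emb ` carrier S) frac"
    using emb_closed emb_mult[symmetric] nonempty closed by (auto simp: subsemigroup_def)
  then have "I_order (emb ` carrier S) frac"
    using frac_left_quotient frac_right_quotient
    by (simp add: I_order_def left_I_order_def right_I_order_def)
  ultimately show ?thesis unfolding is_I_order_in_def by blast
qed

lemma I_order_in_some_primitive: "I_order_in_some_primitive S"
  by (rule I_order_in_some_primitiveI[OF primitive_inverse_semigroup_frac is_I_order_in_frac])

end

text \<open>The last conjunct takes \<open>Q\<close> over an arbitrary type, confirming that the use
  of pairs in \<open>I_order_in_some_primitive\<close> loses no generality.\<close>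

theorem proposition5p5:
  fixes S :: "'a sgrp" and Q :: "'q sgrp"
  assumes "carrier_semigroup S"
  shows
    "(I_order_in_some_primitive S \<longleftrightarrow>
        (\<exists>z. is_zero S z \<and> categorical_at_zero S z \<and> zero_cancellative S z \<and>
             transp_on (carrier S) (lambda_rel S z) \<and> cond_D S z \<and>
             transp_on (carrier S) (rho_rel S z) \<and> cond_D' S z)) \<and>
     (I_order_in_some_primitive S \<longleftrightarrow>
        (\<exists>z. is_zero S z \<and> categorical_at_zero S z \<and> zero_cancellative S z \<and>
             transp_on (carrier S) (lambda_rel S z) \<and> cond_D S z \<and> cond_D' S z \<and>
             (\<forall>a\<in>carrier S. \<forall>b\<in>carrier S. R_star S a b \<longrightarrow> rho_rel S z a b))) \<and>
     (I_order_in_some_primitive S \<longleftrightarrow>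
        (\<exists>z. is_zero S z \<and> categorical_at_zero S z \<and> zero_cancellative S z \<and>
             cond_D S z \<and> cond_D' S z \<and> cond_E S z \<and> cond_E' S z)) \<and>
     (primitive_inverse_semigroup Q \<and> is_I_order_in S Q \<longrightarrow> I_order_in_some_primitive S)"
proof -
  interpret carrier_semigroup S by (rule assms)
  \<comment> \<open>\<open>K\<close> bundles the zero with (A), (B), (D) and (D'), which the three
    lists of conditions share; only \<open>L\<close>, \<open>R\<close>, \<open>RS\<close>, (E) and
    (E') remain to be compared.\<close>
  define K where "K z \<longleftrightarrow> categorical_cancellative S z" for z
  define L where "L z \<longleftrightarrow> transp_on (carrier S) (lambda_rel S z)" for z
  define R where "R z \<longleftrightarrow> transp_on (carrier S) (rho_rel S z)" for z
  define RS where
    "RS z \<longleftrightarrow> (\<forall>a\<in>carrier S. \<forall>b\<in>carrier S. R_star S a b \<longrightarrow> rho_rel S z a b)" for z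
  have K: "K z \<longleftrightarrow> is_zero S z \<and> categorical_at_zero S z \<and> zero_cancellative S z \<and>
      cond_D S z \<and> cond_D' S z" for z
    unfolding K_def categorical_cancellative_def categorical_cancellative_axioms_def
      semigroup_with_zero_def semigroup_with_zero_axioms_def
    using assms by blast
  have one: "\<exists>z. K z \<and> L z \<and> R z" if "primitive_inverse_semigroup Q" "is_I_order_in S Q"
    for Q :: "'r sgrp"
    using primitive_I_order_conditions[OF assms that] by (simp add: K_def L_def R_def)
  have two: "I_order_in_some_primitive S" if "K z \<and> L z \<and> R z" for z
    using that fraction_semigroup.I_order_in_some_primitive[of S z]
    by (simp add: fraction_semigroup_def fraction_semigroup_axioms_def K_def L_def R_def)
  have iff: "I_order_in_some_primitive S \<longleftrightarrow> (\<exists>z. K z \<and> L z \<and> R z)"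
    using one two unfolding I_order_in_some_primitive_def by blast
  have E: "R z \<and> L z \<longleftrightarrow> cond_E S z \<and> cond_E' S z" and RS: "L z \<Longrightarrow> R z \<longleftrightarrow> RS z" if "K z" for z
  proof -
    interpret categorical_cancellative S z using that by (simp add: K_def)
    show "R z \<and> L z \<longleftrightarrow> cond_E S z \<and> cond_E' S z"
      unfolding R_def L_def
      using cond_E_if_transp cond_E'_if_transp transp_rho_if_cond_E transp_lambda_if_cond_E by blast
    show "R z \<longleftrightarrow> RS z"
      unfolding R_def RS_def using cond_E_if_transp R_star_imp_rho transp_rho_if_R_star by blast
  qed
  show ?thesis
    unfolding L_def[symmetric] R_def[symmetric] RS_def[symmetric]
  proof (intro conjI impI)
    show "I_order_in_some_primitive S \<longleftrightarrow> (\<exists>z. is_zero S z \<and> categorical_at_zero S z \<and>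
        zero_cancellative S z \<and> L z \<and> cond_D S z \<and> R z \<and> cond_D' S z)"
      unfolding iff K by blast
    show "I_order_in_some_primitive S \<longleftrightarrow> (\<exists>z. is_zero S z \<and> categorical_at_zero S z \<and>
        zero_cancellative S z \<and> L z \<and> cond_D S z \<and> cond_D' S z \<and> RS z)"
      unfolding iff using K RS by blast
    show "I_order_in_some_primitive S \<longleftrightarrow> (\<exists>z. is_zero S z \<and> categorical_at_zero S z \<and>
        zero_cancellative S z \<and> cond_D S z \<and> cond_D' S z \<and> cond_E S z \<and> cond_E' S z)"
      unfolding iff using K E by blast
    show "I_order_in_some_primitive S" if "primitive_inverse_semigroup Q \<and> is_I_order_in S Q"
      using that I_order_in_some_primitiveI by blast
  qed
qed

end
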